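(* Assume $P(W\mid U)\in\mathscr P$ (partial observability) and that there is $\delta>0$ such that every $\phi=(\theta,\psi,\omega)\in IR_\Phi$ satisfies $\psi_i\ge\delta$ for all $i=1,\dots,d$ (boundedness). Let $\underline{f^n_{opt}(Y_x=y)}$ be the output of the PI-SFP algorithm after $n\ge 1$ iterations, let $L_n$ be the length of the longest nested sequence up to iteration $n$, and let $\underline{f(Y_x=y)}$ be the optimal value of the fractional program (all defined in the context). Then PI-SFP concentrates around $\underline{f(Y_x=y)}$ at the rate $O\big((3/4)^{\lfloor L_n/(4d)\rfloor}\big)$; specifically $$\Big|\underline{f^n_{opt}(Y_x=y)}-\underline{f(Y_x=y)}\Big|\le A\Big(\frac34\Big)^{\lfloor L_n/(4d)\rfloor}\mathrm{dia}(S_0)^2,$$ where $$A=\max_{\gamma\in S_0}\frac{2(\sqrt2+1)\sqrt d}{\delta}\Big\|\frac{\partial (C_1(\gamma)-C_2(\gamma))}{\partial\gamma}\Big\|+\max_{\gamma\in S_0}\Big\|\frac{\partial^2C_1(\gamma)}{\partial\gamma^2}\Big\|_F+\frac12\max_{\gamma\in S_0}\Big\|\frac{\partial^2C_2(\gamma)}{\partial\gamma^2}\Big\|_F<+\infty,$$ with $\|\cdot\|$ the Euclidean norm and $\|\cdot\|_F$ the Frobenius norm, and $L_n\in[\lfloor\log n\rfloor+1,\,n]$. Moreover, $\lim_{n\to+\infty}\underline{f^n_{opt}(Y_x=y)}=\underline{f(Y_x=y)}$.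
   Context: **Setting.** $W,U,X$ are discrete; $U$ takes values $u_1,\dots,u_d$ ($2\le d<\infty$, $U$ latent), $W$ takes $\dim(W)$ values; $Y$ is discrete or continuous. $f$ denotes probability mass (density in $y$). Fix values $x$ and $y$, with $f(X=x)>0$. The column vectors $f(y,W,X=x)$, $f(W,X=x)$, $f(W,X\ne x)\in\mathbb R^{\dim(W)}$ are observed, and so are $f(y,X=x)$, $f(X=x)$, $f(X\neq x)$. $W$ is a proxy of $U$: given $U$, $W$ is independent of $(X,Y)$. $P(W\mid U)$ is the $\dim(W)\times d$ matrix with columns $f(W\mid u_i)$. Known matrices $\underline P,\overline P$ of this size are given, and $\mathscr P$ is the set of $P(W\mid U)$ with $\underline P\le P(W\mid U)\le\overline P$ entrywise. **Feasible region.** Write $\theta,\psi,\omega\in\mathbb R^d$ (standing for $\theta_i=f(y,u_i,X=x)$, $\psi_i=f(u_i,X=x)$, $\omega_i=f(u_i,X\ne x)$) and $\phi=(\theta,\psi,\omega)$. $IR_\Phi$ is the set of $\phi$ with (entrywise inequalities) $\underline P\theta\le f(y,W,X=x)\le\overline P\theta$, $\underline P\psi\le f(W,X=x)\le\overline P\psi$, $\underline P\omega\le f(W,X\ne x)\le\overline P\omega$; $\sum_i\theta_i=f(y,X=x)$, $\sum_i\psi_i=f(X=x)$, $\sum_i\omega_i=f(X\ne x)$; and for all $i$, $\theta_i\in[0,f(y,X=x)]$, $\psi_i\in(0,f(X=x)]$, $\omega_i\in[0,f(X\ne x)]$. Since the true distribution is compatible with the data, $IR_\Phi\ne\emptyset$.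 **Target.** Let $\gamma=(\psi^o,\theta,\psi,\omega)\in\mathbb R^{4d}$ with $\psi^o\in\mathbb R^d$, and $IR_\Gamma=\{\gamma:\phi\in IR_\Phi,\ \psi^o_i\psi_i=1,\ i=1,\dots,d\}$. Then $$\underline{f(Y_x=y)}=\min_{\phi\in IR_\Phi}\Big\{f(y,X=x)+\sum_{i=1}^d\frac{\theta_i\omega_i}{\psi_i}\Big\}=\min_{\gamma\in IR_\Gamma}\Big\{f(y,X=x)+\sum_{i=1}^d\psi^o_i\theta_i\omega_i\Big\}.$$ **DC functions.** With $a_i=\psi^o_i,\ b_i=\theta_i,\ c_i=\omega_i$: $C_1(\gamma)=\sum_{i=1}^d\big[\frac16(a_i+b_i+c_i)^3+\frac12(a_i^4+b_i^4+c_i^4)+\frac12(a_i^2+b_i^2+c_i^2)\big]$, $C_2(\gamma)=\sum_{i=1}^d\big[\frac16(a_i^3+b_i^3+c_i^3)+\frac14\{(a_i^2+b_i)^2+(b_i^2+c_i)^2+(c_i^2+a_i)^2\}+\frac14\{(a_i+b_i^2)^2+(b_i+c_i^2)^2+(c_i+a_i^2)^2\}\big]$, $D_{i1}(\gamma)=\frac12(\psi^o_i+\psi_i)^2$, $D_{i2}(\gamma)=\frac12[(\psi^o_i)^2+\psi_i^2]$. One has $C_1-C_2=\sum_i\psi^o_i\theta_i\omega_i$ and $D_{i1}-D_{i2}=\psi^o_i\psi_i$. For a simplex $S$ in $\mathbb R^{4d}$ with vertices $S^0,\dots,S^{4d}$ and $F$ any of these functions, $F^{\rm tan}(\gamma)=F(\gamma_0)+\nabla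 F(\gamma_0)^T(\gamma-\gamma_0)$ with $\gamma_0\in S$ an arbitrary chosen point, and $F^{\rm sec}$ is the affine function interpolating $F$ at the vertices: $F^{\rm sec}(\sum_j\lambda_jS^j)=\sum_j\lambda_jF(S^j)$ for $\sum_j\lambda_j=1$. **Bounding.** For a simplex $S$, $\underline{\underline{f_S(Y_x=y)}}$ is the optimal value of the linear program: minimize $f(y,X=x)+C_1^{\rm tan}(\gamma)-C_2^{\rm sec}(\gamma)$ over $\gamma\in S$ with $\phi\in IR_\Phi$ and, for all $i$, $D_{i1}^{\rm tan}(\gamma)-D_{i2}^{\rm sec}(\gamma)\le1$ and $D_{i1}^{\rm sec}(\gamma)-D_{i2}^{\rm tan}(\gamma)\ge1$; it is set to $+\infty$ if $IR_\Gamma\cap S=\emptyset$. **Initial simplex.** $\gamma^l_i=\min_{\gamma\in IR_\Gamma}\gamma_i$, $\gamma^u_i=\max_{\gamma\in IR_\Gamma}\gamma_i$, $\psi^l=\min_{2d+1\le i\le3d}\gamma_i^l$, $\psi^u=\max_{2d+1\le i\le3d}\gamma_i^u$, $\alpha=1+f(y,X=x)+\frac{d^2(\psi^l+\psi^u)^2}{4f(X=x)\psi^l\psi^u}$, and $S_0=\{\gamma\in\mathbb R^{4d}:\sum_{i=1}^{4d}\gamma_i\le\alpha,\ \gamma_i\ge\gamma_i^l\ \forall i\}$. $\mathrm{dia}(S)=\max_{s,s'\in S}\|s-s'\|$. **Algorithm PI-SFP.** Start with the collection $\mathcal S_0=\{S_0\}$. For $k=0,1,2,\dots$: choose $\tilde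 S_k\in\arg\min_{S\in\mathcal S_k}\underline{\underline{f_S(Y_x=y)}}$; split $\tilde S_k$ into two simplices by longest-edge bisection (take a longest edge with endpoints the vertices $t_1,t_2$ and its midpoint $v$; the two new simplices are obtained by replacing vertex $t_1$, respectively $t_2$, by $v$); let $\mathcal S_{k+1}$ be $\mathcal S_k$ with $\tilde S_k$ replaced by these two simplices. After $n$ iterations the output is $\underline{f^n_{opt}(Y_x=y)}=\max_{0\le k\le n}\underline{\underline{f_{\tilde S_k}(Y_x=y)}}$. (The stopping rule is ignored here; the algorithm is run for arbitrary $n$.) **$L_n$.** $L_n$ is the largest integer $L$ such that there is a subsequence $\tilde S_{i_0},\tilde S_{i_1},\dots,\tilde S_{i_L}$ of $\tilde S_0,\dots,\tilde S_n$ in which $\tilde S_{i_{j+1}}$ is one of the two simplices obtained by bisecting $\tilde S_{i_j}$ for $j=0,\dots,L-1$. $\log$ is the natural logarithm. *)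

theory Defs
  imports "HOL-Probability.Probability" "HOL-Library.Landau_Symbols"
begin

section \<open>The probabilistic model\<close>

text \<open>
  The values of \<open>U\<close> and \<open>W\<close> are identified with their indices: \<open>U\<close> takes its \<open>d = CARD('d)\<close>
  values in the finite type \<open>'d\<close>, and \<open>W\<close> its \<open>CARD('w)\<close> values in \<open>'w\<close>.  The function \<open>f\<close> is the
  joint probability mass of \<open>(W, U, X)\<close> and density in \<open>y\<close> with respect to a \<open>\<sigma>\<close>-finite reference
  measure \<open>\<nu>\<close>: the counting measure for discrete \<open>Y\<close>, Lebesgue measure for continuous \<open>Y\<close>.
  Conditional independence of \<open>W\<close> and \<open>(X, Y)\<close> given \<open>U\<close> is required of this version of the
  density at every point, since the data involve the density at one fixed \<open>y\<close>.
\<close>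

locale latent_proxy_model = prob_space M + ref: sigma_finite_measure \<nu>
  for M :: "'o measure" and \<nu> :: "'y measure" +
  fixes W :: "'o \<Rightarrow> 'w::finite" and U :: "'o \<Rightarrow> 'd::finite"
    and X :: "'o \<Rightarrow> 'x::countable" and Y :: "'o \<Rightarrow> 'y"
    and f :: "'w \<Rightarrow> 'd \<Rightarrow> 'x \<Rightarrow> 'y \<Rightarrow> real"
  assumes f_nonneg: "0 \<le> f w u x y"
    and joint_density:
      "distributed M
         (count_space UNIV \<Otimes>\<^sub>M count_space UNIV \<Otimes>\<^sub>M count_space UNIV \<Otimes>\<^sub>M \<nu>)
         (\<lambda>\<omega>. (W \<omega>, U \<omega>, X \<omega>, Y \<omega>)) (\<lambda>(w, u, x, y). ennreal (f w u x y))"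
    and U_takes_value: "0 < \<P>(\<omega> in M. U \<omega> = u)"
    and proxy: "y \<in> space \<nu> \<Longrightarrow>
      f w u x y * \<P>(\<omega> in M. U \<omega> = u)
        = \<P>(\<omega> in M. W \<omega> = w \<and> U \<omega> = u) * (\<Sum>w'\<in>UNIV. f w' u x y)"

definition proxy_matrix :: "'o measure \<Rightarrow> ('o \<Rightarrow> 'w::finite) \<Rightarrow> ('o \<Rightarrow> 'd::finite) \<Rightarrow> real^'d^'w" where
  "proxy_matrix M W U = (\<chi> w u. \<P>(\<omega> in M. W \<omega> = w \<bar> U \<omega> = u))"

text \<open>
  What is known to the analyst: \<open>f(y,W,X=x)\<close>, \<open>f(W,X=x)\<close>, \<open>f(W,X\<noteq>x)\<close>, \<open>f(y,X=x)\<close>, \<open>f(X=x)\<close>,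
  \<open>f(X\<noteq>x)\<close>, and the entrywise bounds on the proxy matrix.
\<close>

record ('w, 'd) known_data =
  fyWx :: "real^'w"
  fWx :: "real^'w"
  fWnx :: "real^'w"
  fyx :: real
  fx :: real
  fnx :: real
  Plow :: "real^'d^'w"
  Pupp :: "real^'d^'w"

definition known_data_of ::
  "'o measure \<Rightarrow> ('o \<Rightarrow> 'w::finite) \<Rightarrow> ('o \<Rightarrow> 'x) \<Rightarrow> ('w \<Rightarrow> 'd::finite \<Rightarrow> 'x \<Rightarrow> 'y \<Rightarrow> real) \<Rightarrow>
     'x \<Rightarrow> 'y \<Rightarrow> real^'d^'w \<Rightarrow> real^'d^'w \<Rightarrow> ('w, 'd) known_data" where
  "known_data_of M W X f x y P P' =
     \<lparr> fyWx = (\<chi> w. \<Sum>u\<in>UNIV. f w u x y),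
       fWx = (\<chi> w. \<P>(\<omega> in M. W \<omega> = w \<and> X \<omega> = x)),
       fWnx = (\<chi> w. \<P>(\<omega> in M. W \<omega> = w \<and> X \<omega> \<noteq> x)),
       fyx = (\<Sum>w\<in>UNIV. \<Sum>u\<in>UNIV. f w u x y),
       fx = \<P>(\<omega> in M. X \<omega> = x),
       fnx = \<P>(\<omega> in M. X \<omega> \<noteq> x),
       Plow = P, Pupp = P' \<rparr>"


section \<open>The fractional program\<close>

type_synonym 'd phi = "(real^'d) \<times> (real^'d) \<times> (real^'d)"

text \<open>
  A point \<open>\<gamma> = (\<psi>\<^sup>o, \<theta>, \<psi>, \<omega>)\<close> of the 4d-dimensional Euclidean space; \<open>snd \<gamma>\<close> is its part \<open>\<phi>\<close>.  The
  norm of the product type is the Euclidean norm, and the 4d coordinates of \<open>\<gamma>\<close> are the inner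
  products \<open>\<gamma> \<bullet> b\<close> with \<open>b \<in> Basis\<close>.
\<close>

type_synonym 'd gam = "(real^'d) \<times> 'd phi"

definition IR_Phi :: "('w::finite, 'd::finite) known_data \<Rightarrow> 'd phi set" where
  "IR_Phi D = {(\<theta>, \<psi>, \<omega>).
     Plow D *v \<theta> \<le> fyWx D \<and> fyWx D \<le> Pupp D *v \<theta> \<and>
     Plow D *v \<psi> \<le> fWx D \<and> fWx D \<le> Pupp D *v \<psi> \<and>
     Plow D *v \<omega> \<le> fWnx D \<and> fWnx D \<le> Pupp D *v \<omega> \<and>
     (\<Sum>i\<in>UNIV. \<theta> $ i) = fyx D \<and> (\<Sum>i\<in>UNIV. \<psi> $ i) = fx D \<and> (\<Sum>i\<in>UNIV. \<omega> $ i) = fnx D \<and>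
     (\<forall>i. \<theta> $ i \<in> {0..fyx D} \<and> \<psi> $ i \<in> {0<..fx D} \<and> \<omega> $ i \<in> {0..fnx D})}"

definition IR_Gamma :: "('w::finite, 'd::finite) known_data \<Rightarrow> 'd gam set" where
  "IR_Gamma D = {(\<psi>o, \<theta>, \<psi>, \<omega>). (\<theta>, \<psi>, \<omega>) \<in> IR_Phi D \<and> (\<forall>i. \<psi>o $ i * \<psi> $ i = 1)}"

definition f_low :: "('w::finite, 'd::finite) known_data \<Rightarrow> real" where
  "f_low D = (INF (\<theta>, \<psi>, \<omega>)\<in>IR_Phi D. fyx D + (\<Sum>i\<in>UNIV. \<theta> $ i * \<omega> $ i / \<psi> $ i))"


section \<open>Difference-of-convex decomposition\<close>

definition C1 :: "'d::finite gam \<Rightarrow> real" where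
  "C1 = (\<lambda>(a, b, \<psi>, c). \<Sum>i\<in>UNIV.
     1/6 * (a$i + b$i + c$i)^3 + 1/2 * ((a$i)^4 + (b$i)^4 + (c$i)^4)
     + 1/2 * ((a$i)^2 + (b$i)^2 + (c$i)^2))"

definition C2 :: "'d::finite gam \<Rightarrow> real" where
  "C2 = (\<lambda>(a, b, \<psi>, c). \<Sum>i\<in>UNIV.
     1/6 * ((a$i)^3 + (b$i)^3 + (c$i)^3)
     + 1/4 * (((a$i)^2 + b$i)^2 + ((b$i)^2 + c$i)^2 + ((c$i)^2 + a$i)^2)
     + 1/4 * ((a$i + (b$i)^2)^2 + (b$i + (c$i)^2)^2 + (c$i + (a$i)^2)^2))"

definition D1 :: "'d::finite \<Rightarrow> 'd gam \<Rightarrow> real" where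
  "D1 i = (\<lambda>(\<psi>o, \<theta>, \<psi>, \<omega>). 1/2 * (\<psi>o$i + \<psi>$i)^2)"

definition D2 :: "'d::finite \<Rightarrow> 'd gam \<Rightarrow> real" where
  "D2 i = (\<lambda>(\<psi>o, \<theta>, \<psi>, \<omega>). 1/2 * ((\<psi>o$i)^2 + (\<psi>$i)^2))"

definition gradient :: "('a::euclidean_space \<Rightarrow> real) \<Rightarrow> 'a \<Rightarrow> 'a" where
  "gradient F p = (THE g. GDERIV F p :> g)"

definition hessian_entry :: "('a::euclidean_space \<Rightarrow> real) \<Rightarrow> 'a \<Rightarrow> 'a \<Rightarrow> 'a \<Rightarrow> real" where
  "hessian_entry F p b b' = gradient (\<lambda>q. gradient F q \<bullet> b) p \<bullet> b'"

definition hessian_frobenius :: "('a::euclidean_space \<Rightarrow> real) \<Rightarrow> 'a \<Rightarrow> real" where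
  "hessian_frobenius F p = sqrt (\<Sum>b\<in>Basis. \<Sum>b'\<in>Basis. (hessian_entry F p b b')^2)"

text \<open>
  A simplex is given by the list of its vertices; as a point set it is their convex hull.  The
  point of tangency \<open>tp S F\<close> is an arbitrary choice, which may depend on the simplex and on the
  function to be linearised.
\<close>

type_synonym 'd vsimplex = "'d gam list"

type_synonym 'd tangency = "'d vsimplex \<Rightarrow> ('d gam \<Rightarrow> real) \<Rightarrow> 'd gam"

abbreviation hull_of :: "'d::finite vsimplex \<Rightarrow> 'd gam set" where
  "hull_of S \<equiv> convex hull (set S)"

definition tan_approx ::
  "'d tangency \<Rightarrow> 'd::finite vsimplex \<Rightarrow> ('d gam \<Rightarrow> real) \<Rightarrow> 'd gam \<Rightarrow> real" where
  "tan_approx tp S F \<gamma> = F (tp S F) + gradient F (tp S F) \<bullet> (\<gamma> - tp S F)"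

text \<open>
  The value below is unique for affinely independent vertices, and also when all vertices
  coincide and \<open>\<gamma>\<close> is that point; the latter happens if the initial simplex is a single point.
\<close>

definition sec_approx :: "'d::finite vsimplex \<Rightarrow> ('d gam \<Rightarrow> real) \<Rightarrow> 'd gam \<Rightarrow> real" where
  "sec_approx S F \<gamma> = (THE v. \<exists>l::nat \<Rightarrow> real.
     (\<Sum>j<length S. l j) = 1 \<and> \<gamma> = (\<Sum>j<length S. l j *\<^sub>R (S ! j)) \<and>
     v = (\<Sum>j<length S. l j * F (S ! j)))"

definition lp_feasible ::
  "('w::finite, 'd::finite) known_data \<Rightarrow> 'd tangency \<Rightarrow> 'd vsimplex \<Rightarrow> 'd gam set" where
  "lp_feasible D tp S = {\<gamma> \<in> hull_of S. snd \<gamma> \<in> IR_Phi D \<and>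
     (\<forall>i. tan_approx tp S (D1 i) \<gamma> - sec_approx S (D2 i) \<gamma> \<le> 1 \<and>
          sec_approx S (D1 i) \<gamma> - tan_approx tp S (D2 i) \<gamma> \<ge> 1)}"

definition lp_bound ::
  "('w::finite, 'd::finite) known_data \<Rightarrow> 'd tangency \<Rightarrow> 'd vsimplex \<Rightarrow> ereal" where
  "lp_bound D tp S =
     (if IR_Gamma D \<inter> hull_of S = {} then \<infinity>
      else INF \<gamma>\<in>lp_feasible D tp S. ereal (fyx D + tan_approx tp S C1 \<gamma> - sec_approx S C2 \<gamma>))"


section \<open>The initial simplex\<close>

definition gam_low :: "('w::finite, 'd::finite) known_data \<Rightarrow> 'd gam \<Rightarrow> real" where
  "gam_low D b = (INF \<gamma>\<in>IR_Gamma D. \<gamma> \<bullet> b)"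

definition gam_upp :: "('w::finite, 'd::finite) known_data \<Rightarrow> 'd gam \<Rightarrow> real" where
  "gam_upp D b = (SUP \<gamma>\<in>IR_Gamma D. \<gamma> \<bullet> b)"

abbreviation psi_coord :: "'d::finite \<Rightarrow> 'd gam" where
  "psi_coord i \<equiv> (0, 0, axis i 1, 0)"

definition psi_low :: "('w::finite, 'd::finite) known_data \<Rightarrow> real" where
  "psi_low D = Min (range (\<lambda>i. gam_low D (psi_coord i)))"

definition psi_upp :: "('w::finite, 'd::finite) known_data \<Rightarrow> real" where
  "psi_upp D = Max (range (\<lambda>i. gam_upp D (psi_coord i)))"

definition alpha :: "('w::finite, 'd::finite) known_data \<Rightarrow> real" where
  "alpha D = 1 + fyx D
     + (real CARD('d))^2 * (psi_low D + psi_upp D)^2 / (4 * fx D * psi_low D * psi_upp D)"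

definition S0 :: "('w::finite, 'd::finite) known_data \<Rightarrow> 'd gam set" where
  "S0 D = {\<gamma>. (\<Sum>b\<in>Basis. \<gamma> \<bullet> b) \<le> alpha D \<and> (\<forall>b\<in>Basis. \<gamma> \<bullet> b \<ge> gam_low D b)}"


section \<open>The algorithm\<close>

definition longest_edge_bisection ::
  "'d::finite vsimplex \<Rightarrow> 'd vsimplex \<Rightarrow> 'd vsimplex \<Rightarrow> bool" where
  "longest_edge_bisection S T T' \<longleftrightarrow>
     (\<exists>i<length S. \<exists>j<length S. i \<noteq> j \<and>
        (\<forall>p<length S. \<forall>q<length S. dist (S ! p) (S ! q) \<le> dist (S ! i) (S ! j)) \<and>
        T = S[i := midpoint (S ! i) (S ! j)] \<and>
        T' = S[j := midpoint (S ! i) (S ! j)])"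

text \<open>
  A run of the algorithm, with all its choices: \<open>Coll k\<close> is the collection of simplices before
  iteration \<open>k\<close>, \<open>sel k\<close> the simplex selected from it, and \<open>T k\<close>, \<open>T' k\<close> the two halves of \<open>sel k\<close>.
\<close>

definition pi_sfp_run ::
  "('w::finite, 'd::finite) known_data \<Rightarrow> 'd tangency \<Rightarrow> (nat \<Rightarrow> 'd vsimplex multiset) \<Rightarrow>
     (nat \<Rightarrow> 'd vsimplex) \<Rightarrow> (nat \<Rightarrow> 'd vsimplex) \<Rightarrow> (nat \<Rightarrow> 'd vsimplex) \<Rightarrow> bool" where
  "pi_sfp_run D tp Coll sel T T' \<longleftrightarrow>
     (\<exists>V. length V = 4 * CARD('d) + 1 \<and> hull_of V = S0 D \<and> Coll 0 = {#V#}) \<and>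
     (\<forall>k. sel k \<in># Coll k \<and>
          (\<forall>S. S \<in># Coll k \<longrightarrow> lp_bound D tp (sel k) \<le> lp_bound D tp S) \<and>
          longest_edge_bisection (sel k) (T k) (T' k) \<and>
          Coll (Suc k) = Coll k - {#sel k#} + {#T k, T' k#})"

definition f_opt ::
  "('w::finite, 'd::finite) known_data \<Rightarrow> 'd tangency \<Rightarrow> (nat \<Rightarrow> 'd vsimplex) \<Rightarrow> nat \<Rightarrow> ereal" where
  "f_opt D tp sel n = Max ((\<lambda>k. lp_bound D tp (sel k)) ` {0..n})"

definition longest_nested ::
  "(nat \<Rightarrow> 'd vsimplex) \<Rightarrow> (nat \<Rightarrow> 'd vsimplex) \<Rightarrow> (nat \<Rightarrow> 'd vsimplex) \<Rightarrow> nat \<Rightarrow> nat" where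
  "longest_nested sel T T' n = (GREATEST L. \<exists>i::nat \<Rightarrow> nat.
     strict_mono_on {0..L} i \<and> i L \<le> n \<and>
     (\<forall>j<L. sel (i (Suc j)) \<in> {T (i j), T' (i j)}))"

text \<open>The suprema are taken in the extended reals, so that finiteness is a genuine claim.\<close>

definition rate_const :: "('w::finite, 'd::finite) known_data \<Rightarrow> real \<Rightarrow> ereal" where
  "rate_const D \<delta> =
     (SUP \<gamma>\<in>S0 D. ereal (2 * (sqrt 2 + 1) * sqrt (real CARD('d)) / \<delta>
                          * norm (gradient (\<lambda>\<gamma>. C1 \<gamma> - C2 \<gamma>) \<gamma>)))
     + (SUP \<gamma>\<in>S0 D. ereal (hessian_frobenius C1 \<gamma>))
     + ereal (1/2) * (SUP \<gamma>\<in>S0 D. ereal (hessian_frobenius C2 \<gamma>))"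

end

theory Submission
  imports Defs
begin

text \<open>
  Each linear program is a relaxation of the fractional program on its simplex, and the relaxation
  error is quadratic in the size of the simplex.

  Tangents of convex functions underestimate and secants overestimate, hence a linear program never
  has a value above the objective at a point of \<open>IR_Gamma\<close> in its simplex (\<open>lp_bound_le\<close>).  The
  simplices of a run always cover \<open>IR_Gamma\<close>, because the initial simplex does
  (\<open>IR_Gamma_subset_S0\<close>, by Kantorovich's inequality) and the halves of a simplex cover it.  So the
  smallest bound, which belongs to the selected simplex, is at most the optimal value
  (\<open>lp_bound_sel_le\<close>), and so is the output.

  For the other direction, let all edges of a simplex have squared length at most \<open>h\<close>.  Then tangents
  and secants are off by at most half the curvature times \<open>h\<close>.  A feasible point of the linear
  program therefore violates the constraints \<open>\<psi>\<^sup>o\<^sub>i \<psi>\<^sub>i = 1\<close> by a multiple of \<open>h\<close> only; since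
  \<open>\<psi>\<^sub>i \<ge> \<delta>\<close>, repairing \<open>\<psi>\<^sup>o\<close> moves it by a distance of order \<open>h / \<delta>\<close> into \<open>IR_Gamma\<close>.  The cost of
  the move and the errors in the objective add up to at most \<open>rate * h\<close> (\<open>lp_bound_ge\<close>).

  By Kearfott's argument, \<open>4 d\<close> successive longest-edge bisections multiply the squared diameter by
  at most \<open>3/4\<close> (\<open>bisection_round\<close>), so the last simplex of a longest nested sequence has
  \<open>h \<le> (3/4)^(L div 4 d) * dia\<^sup>2\<close>, which is the rate.  Finally, the selected simplices are the inner
  nodes of a binary tree, and a binary tree with many leaves is deep (\<open>two_power_depth\<close>); this bounds
  the length of the nested sequence from below by the logarithm and forces convergence.
\<close>

section \<open>Gradients and Hessians of polynomial functions\<close>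

lemma gradient_eqI:
  assumes "GDERIV F p :> g"
  shows "gradient F p = g"
  unfolding gradient_def
proof (rule the_equality)
  show "GDERIV F p :> g" by (rule assms)
next
  fix g' assume "GDERIV F p :> g'"
  then have "(\<lambda>h. h \<bullet> g') = (\<lambda>h. h \<bullet> g)"
    using assms unfolding gderiv_def by (rule has_derivative_unique)
  then show "g' = g"
    by (metis vector_eq_ldot)
qed

lemma real_polynomial_function_inner:
  assumes "polynomial_function g"
  shows "real_polynomial_function (\<lambda>x. g x \<bullet> b)"
proof -
  have "real_polynomial_function ((\<lambda>y. y \<bullet> b) \<circ> g)"
    using assms bounded_linear_inner_left unfolding polynomial_function_def by blast
  then show ?thesis by (simp add: o_def)
qed

text \<open>
  All functions of the decomposition are polynomials.  Carrying out the induction over polynomial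
  functions once shows that gradients exist and are again polynomial; iterating gives Hessians, and
  with them smoothness and boundedness on compact sets, without differentiating any of the
  concrete functions.
\<close>

lemma real_polynomial_function_ex_gradient:
  fixes F :: "'a::euclidean_space \<Rightarrow> real"
  assumes "real_polynomial_function F"
  shows "\<exists>g. polynomial_function g \<and> (\<forall>p. GDERIV F p :> g p)"
  using assms
proof induction
  case (linear F)
  obtain w where w: "F = (\<lambda>x. x \<bullet> w)"
  proof
    show "F = (\<lambda>x. x \<bullet> (\<Sum>b\<in>Basis. F b *\<^sub>R b))"
    proof
      fix x
      have "F x = F (\<Sum>b\<in>Basis. (x \<bullet> b) *\<^sub>R b)" by (simp add: euclidean_representation)
      also have "\<dots> = x \<bullet> (\<Sum>b\<in>Basis. F b *\<^sub>R b)"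
        by (simp add: linear_sum linear_scale bounded_linear.linear[OF linear] inner_sum_right
            mult.commute)
      finally show "F x = x \<bullet> (\<Sum>b\<in>Basis. F b *\<^sub>R b)" .
    qed
  qed
  show ?case
    by (intro exI[of _ "\<lambda>_. w"])
      (auto simp: w gderiv_def intro!: bounded_linear_imp_has_derivative bounded_linear_inner_left)
next
  case (const c)
  then show ?case by (intro exI[of _ "\<lambda>_. 0"]) (auto intro: GDERIV_const)
next
  case (add F G)
  then obtain g h where "polynomial_function g" "polynomial_function h"
    "\<forall>p. GDERIV F p :> g p" "\<forall>p. GDERIV G p :> h p" by blast
  then show ?case
    by (intro exI[of _ "\<lambda>p. g p + h p"]) (auto intro: GDERIV_add)
next
  case (mult F G)
  then obtain g h where gh: "polynomial_function g" "polynomial_function h"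
    "\<forall>p. GDERIV F p :> g p" "\<forall>p. GDERIV G p :> h p" by blast
  moreover have "polynomial_function (\<lambda>p. F p *\<^sub>R h p + G p *\<^sub>R g p)"
    using mult gh by (auto simp: real_polynomial_function_eq)
  ultimately show ?case
    by (intro exI[of _ "\<lambda>p. F p *\<^sub>R h p + G p *\<^sub>R g p"]) (auto intro: GDERIV_mult)
qed

lemma
  fixes F :: "'a::euclidean_space \<Rightarrow> real"
  assumes "real_polynomial_function F"
  shows GDERIV_gradient: "GDERIV F p :> gradient F p"
    and polynomial_function_gradient: "polynomial_function (gradient F)"
proof -
  obtain g where g: "polynomial_function g" "\<forall>p. GDERIV F p :> g p"
    using real_polynomial_function_ex_gradient[OF assms] by blast
  then have "gradient F = g" by (auto intro!: gradient_eqI)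
  with g show "GDERIV F p :> gradient F p" "polynomial_function (gradient F)" by auto
qed

lemma real_polynomial_function_hessian_entry:
  assumes "real_polynomial_function F"
  shows "real_polynomial_function (\<lambda>p. hessian_entry F p b b')"
  unfolding hessian_entry_def
  by (intro real_polynomial_function_inner polynomial_function_gradient assms)

lemma continuous_on_hessian_frobenius:
  assumes "real_polynomial_function F"
  shows "continuous_on C (hessian_frobenius F)"
proof -
  have "continuous_on C (\<lambda>p. hessian_entry F p b b')" for b b'
    using real_polynomial_function_hessian_entry[OF assms]
    by (simp add: continuous_on_polymonial_function real_polynomial_function_eq)
  then show ?thesis
    unfolding hessian_frobenius_def by (intro continuous_intros) auto
qed

lemma DERIV_along_line:
  fixes F :: "'a::euclidean_space \<Rightarrow> real"
  assumes "real_polynomial_function F"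
  shows "((\<lambda>t. F (p + t *\<^sub>R v)) has_real_derivative gradient F (p + t *\<^sub>R v) \<bullet> v) (at t)"
proof -
  have "((\<lambda>t. p + t *\<^sub>R v) has_derivative (\<lambda>h. h *\<^sub>R v)) (at t)"
    by (auto intro!: derivative_eq_intros)
  from has_derivative_compose[OF this GDERIV_gradient[OF assms, unfolded gderiv_def]]
  show ?thesis
    by (simp add: has_field_derivative_def inner_commute mult_commute_abs)
qed

lemma quadratic_form_le_hessian_frobenius:
  fixes v :: "'a::euclidean_space"
  shows "(\<Sum>b\<in>Basis. \<Sum>b'\<in>Basis. (v \<bullet> b) * (v \<bullet> b') * hessian_entry F p b b')
     \<le> hessian_frobenius F p * (norm v)\<^sup>2"
proof -
  let ?H = "\<lambda>b b'. hessian_entry F p b b'"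
  have v2: "(\<Sum>b\<in>Basis. (v \<bullet> b)\<^sup>2) = (norm v)\<^sup>2"
    unfolding power2_norm_eq_inner
    by (subst euclidean_inner[of v v]) (simp add: power2_eq_square)
  have "(\<Sum>b\<in>Basis. \<Sum>b'\<in>Basis. (v \<bullet> b) * (v \<bullet> b') * ?H b b')
      = (\<Sum>c\<in>Basis\<times>Basis. ((v \<bullet> fst c) * (v \<bullet> snd c)) * ?H (fst c) (snd c))"
    by (simp add: sum.cartesian_product case_prod_beta)
  also have "\<dots> \<le> L2_set (\<lambda>c. (v \<bullet> fst c) * (v \<bullet> snd c)) (Basis\<times>Basis)
      * L2_set (\<lambda>c. ?H (fst c) (snd c)) (Basis\<times>Basis)"
    by (rule order_trans[OF sum_mono L2_set_mult_ineq]) (metis abs_ge_self abs_mult)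
  also have "L2_set (\<lambda>c. (v \<bullet> fst c) * (v \<bullet> snd c)) (Basis\<times>Basis) = (norm v)\<^sup>2"
  proof -
    have "(\<Sum>c\<in>Basis\<times>Basis. ((v \<bullet> fst c) * (v \<bullet> snd c))\<^sup>2)
       = (\<Sum>b\<in>Basis. (v \<bullet> b)\<^sup>2) * (\<Sum>b\<in>Basis. (v \<bullet> b)\<^sup>2)"
      by (simp add: sum_product sum.cartesian_product case_prod_beta power_mult_distrib)
    then show ?thesis
      unfolding L2_set_def v2 by (intro real_sqrt_unique) (simp_all add: power2_eq_square)
  qed
  also have "L2_set (\<lambda>c. ?H (fst c) (snd c)) (Basis\<times>Basis) = hessian_frobenius F p"
    by (simp add: L2_set_def hessian_frobenius_def sum.cartesian_product case_prod_beta)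
  finally show ?thesis by (simp add: mult.commute)
qed

text \<open>
  The Bregman divergence is the error of the tangent plane at \<open>p\<close>, seen at \<open>q\<close>.  The errors of
  the tangent and of the secant approximation are both expressible through it.
\<close>

definition bregman :: "('a::euclidean_space \<Rightarrow> real) \<Rightarrow> 'a \<Rightarrow> 'a \<Rightarrow> real" where
  "bregman F p q = F q - F p - gradient F p \<bullet> (q - p)"

text \<open>
  Second-order Taylor expansion along the segment from \<open>p\<close> to \<open>q\<close>: the remainder is half of
  the Hessian form at an intermediate point, which Cauchy-Schwarz bounds by the Frobenius norm.
\<close>

lemma bregman_le_hessian_frobenius:
  fixes F :: "'a::euclidean_space \<Rightarrow> real"
  assumes F: "real_polynomial_function F" and "convex C" "p \<in> C" "q \<in> C"
    and K: "\<And>z. z \<in> C \<Longrightarrow> hessian_frobenius F z \<le> K"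
  shows "bregman F p q \<le> K / 2 * (dist p q)\<^sup>2"
proof -
  define v where "v = q - p"
  define \<phi> where "\<phi> t = F (p + t *\<^sub>R v)" for t
  define \<phi>1 where "\<phi>1 t = gradient F (p + t *\<^sub>R v) \<bullet> v" for t
  define \<phi>2 where "\<phi>2 t =
    (\<Sum>b\<in>Basis. \<Sum>b'\<in>Basis. (v \<bullet> b) * (v \<bullet> b') * hessian_entry F (p + t *\<^sub>R v) b b')" for t
  have d1: "(\<phi> has_real_derivative \<phi>1 t) (at t)" for t
    unfolding \<phi>_def \<phi>1_def by (rule DERIV_along_line[OF F])
  have d2: "(\<phi>1 has_real_derivative \<phi>2 t) (at t)" for t
  proof -
    have "((\<lambda>t. \<Sum>b\<in>Basis. (v \<bullet> b) * (gradient F (p + t *\<^sub>R v) \<bullet> b)) has_real_derivative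
       (\<Sum>b\<in>Basis. (v \<bullet> b) * (gradient (\<lambda>q. gradient F q \<bullet> b) (p + t *\<^sub>R v) \<bullet> v))) (at t)"
      by (intro DERIV_sum DERIV_cmult DERIV_along_line real_polynomial_function_inner
          polynomial_function_gradient F)
    moreover have "(\<lambda>t. \<Sum>b\<in>Basis. (v \<bullet> b) * (gradient F (p + t *\<^sub>R v) \<bullet> b)) = \<phi>1"
      unfolding \<phi>1_def by (subst euclidean_inner) (simp add: mult.commute)
    moreover have "(\<Sum>b\<in>Basis. (v \<bullet> b) * (gradient (\<lambda>q. gradient F q \<bullet> b) (p + t *\<^sub>R v) \<bullet> v))
       = \<phi>2 t"
      unfolding \<phi>2_def hessian_entry_def
      by (subst euclidean_inner) (simp add: sum_distrib_left mult_ac)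
    ultimately show ?thesis by simp
  qed
  define diff where "diff m = (if m = 0 then \<phi> else if m = 1 then \<phi>1 else \<phi>2)" for m :: nat
  have "\<exists>t. 0 < t \<and> t < 1 \<and>
      \<phi> 1 = (\<Sum>m<2. diff m 0 / fact m * 1 ^ m) + diff 2 t / fact 2 * 1 ^ 2"
    by (rule Maclaurin) (auto simp: diff_def d1 d2 less_2_cases_iff)
  then obtain t where t: "0 < t" "t < 1" and eq: "\<phi> 1 = \<phi> 0 + \<phi>1 0 + \<phi>2 t / 2"
    by (auto simp: diff_def numeral_2_eq_2)
  have "p + t *\<^sub>R v = (1 - t) *\<^sub>R p + t *\<^sub>R q" by (simp add: v_def algebra_simps)
  then have inC: "p + t *\<^sub>R v \<in> C"
    using assms(2-4) t by (simp add: convex_alt)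
  have "bregman F p q = \<phi>2 t / 2"
    using eq by (simp add: bregman_def \<phi>_def \<phi>1_def v_def)
  also have "\<phi>2 t \<le> hessian_frobenius F (p + t *\<^sub>R v) * (norm v)\<^sup>2"
    unfolding \<phi>2_def by (rule quadratic_form_le_hessian_frobenius)
  also have "\<dots> \<le> K * (norm v)\<^sup>2"
    by (intro mult_right_mono K inC) simp
  finally show ?thesis by (simp add: v_def dist_norm norm_minus_commute)
qed

text \<open>
  For a convex function the difference quotients at \<open>p\<close> in the direction of \<open>q\<close> stay below
  \<open>F q - F p\<close>, hence so does their limit.
\<close>

lemma bregman_nonneg:
  fixes F :: "'a::euclidean_space \<Rightarrow> real"
  assumes F: "real_polynomial_function F" and conv: "convex_on C F" and pq: "p \<in> C" "q \<in> C"
  shows "0 \<le> bregman F p q"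
proof -
  define v where "v = q - p"
  have "((\<lambda>t. F (p + t *\<^sub>R v)) has_real_derivative gradient F p \<bullet> v) (at 0)"
    using DERIV_along_line[OF F, of p v 0] by simp
  then have lim: "((\<lambda>t. (F (p + t *\<^sub>R v) - F p) / t) \<longlongrightarrow> gradient F p \<bullet> v) (at_right 0)"
    by (auto simp: DERIV_def intro: filterlim_mono[OF _ order_refl at_le])
  have "(F (p + t *\<^sub>R v) - F p) / t \<le> F q - F p" if "0 < t" "t < 1" for t
  proof -
    have "p + t *\<^sub>R v = (1 - t) *\<^sub>R p + t *\<^sub>R q" by (simp add: v_def algebra_simps)
    then have "F (p + t *\<^sub>R v) \<le> (1 - t) * F p + t * F q"
      using convex_onD[OF conv, of t p q] that pq by simp
    then show ?thesis using that by (simp add: field_simps)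
  qed
  then have "\<forall>\<^sub>F t in at_right 0. (F (p + t *\<^sub>R v) - F p) / t \<le> F q - F p"
    by (intro eventually_at_right_less[THEN eventually_elim2, OF eventually_at_right_field[THEN iffD2]])
       (auto intro: exI[of _ 1])
  from tendsto_upperbound[OF lim this] show ?thesis
    by (simp add: bregman_def v_def)
qed

lemma polynomial_lipschitz:
  fixes F :: "'a::euclidean_space \<Rightarrow> real"
  assumes F: "real_polynomial_function F" and "convex C" "p \<in> C" "q \<in> C"
    and G: "\<And>z. z \<in> C \<Longrightarrow> norm (gradient F z) \<le> G"
  shows "\<bar>F q - F p\<bar> \<le> G * dist p q"
proof -
  define v where "v = q - p"
  have "\<exists>t. 0 < t \<and> t < 1 \<and> F (p + 1 *\<^sub>R v) - F (p + 0 *\<^sub>R v)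
      = (1 - 0) * (gradient F (p + t *\<^sub>R v) \<bullet> v)"
    by (rule MVT2) (auto intro: DERIV_along_line[OF F])
  then obtain t where t: "0 < t" "t < 1" and eq: "F q - F p = gradient F (p + t *\<^sub>R v) \<bullet> v"
    by (auto simp: v_def)
  have "p + t *\<^sub>R v = (1 - t) *\<^sub>R p + t *\<^sub>R q" by (simp add: v_def algebra_simps)
  then have "p + t *\<^sub>R v \<in> C"
    using assms(2-4) t by (simp add: convex_alt)
  then have "\<bar>gradient F (p + t *\<^sub>R v) \<bullet> v\<bar> \<le> G * norm v"
    by (intro order_trans[OF Cauchy_Schwarz_ineq2] mult_right_mono G) auto
  then show ?thesis by (simp add: eq v_def dist_norm norm_minus_commute)
qed

section \<open>The functions of the decomposition\<close>

text \<open>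
  Convexity and a second-order bound \<open>K\<close> in one predicate.  It asks for exactly what the error
  estimates for tangents and secants consume, so that the quartic \<open>C1\<close>, \<open>C2\<close> and the
  quadratic \<open>D1\<close>, \<open>D2\<close> can be treated alike.
\<close>

definition smooth_convex_on :: "'a::euclidean_space set \<Rightarrow> real \<Rightarrow> ('a \<Rightarrow> real) \<Rightarrow> bool" where
  "smooth_convex_on C K F \<longleftrightarrow>
     (\<forall>p\<in>C. \<forall>q\<in>C. 0 \<le> bregman F p q \<and> bregman F p q \<le> K / 2 * (dist p q)\<^sup>2)"

lemma smooth_convex_on_subset:
  "smooth_convex_on C K F \<Longrightarrow> B \<subseteq> C \<Longrightarrow> smooth_convex_on B K F"
  by (auto simp: smooth_convex_on_def)

lemma convex_on_linear:
  assumes "linear f" "convex C"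
  shows "convex_on C (f :: 'a::real_vector \<Rightarrow> real)"
  using assms by (auto simp: convex_on_def linear_add linear_scale)

lemma convex_on_power:
  fixes f :: "'a::real_vector \<Rightarrow> real"
  assumes f: "convex_on C f" and nonneg: "\<And>x. x \<in> C \<Longrightarrow> 0 \<le> f x"
  shows "convex_on C (\<lambda>x. f x ^ n)"
  unfolding convex_on_def
proof (intro conjI ballI allI impI)
  show "convex C" using f by (simp add: convex_on_def)
  fix x y and u v :: real
  assume xy: "x \<in> C" "y \<in> C" and uv: "0 \<le> u" "0 \<le> v" "u + v = 1"
  have pow: "convex_on {0::real..} (\<lambda>x. x ^ n)"
    by (cases "even n") (auto intro: convex_power_odd convex_on_subset[OF convex_power_even])
  have inC: "u *\<^sub>R x + v *\<^sub>R y \<in> C"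
    using \<open>convex C\<close> xy uv by (simp add: convex_def)
  have "f (u *\<^sub>R x + v *\<^sub>R y) \<le> u * f x + v * f y"
    using f xy uv by (simp add: convex_on_def)
  then have "f (u *\<^sub>R x + v *\<^sub>R y) ^ n \<le> (u * f x + v * f y) ^ n"
    by (intro power_mono nonneg inC)
  also have "\<dots> \<le> u * f x ^ n + v * f y ^ n"
    using pow uv nonneg xy by (simp add: convex_on_def)
  finally show "f (u *\<^sub>R x + v *\<^sub>R y) ^ n \<le> u * f x ^ n + v * f y ^ n" .
qed

lemma convex_on_finite_sum:
  assumes "finite I" "convex C" "\<And>i. i \<in> I \<Longrightarrow> convex_on C (\<lambda>x. f i x)"
  shows "convex_on C (\<lambda>x. \<Sum>i\<in>I. f i x)"
  using assms by (induction I rule: finite_induct) (auto intro!: convex_on_add simp: convex_on_const)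

text \<open>
  \<open>C1\<close> and \<open>C2\<close> are built from powers of convex expressions.  Such a power is convex where
  the expression is nonnegative, and this cone, which contains the initial simplex, guarantees it.
\<close>

definition nonneg_orthant :: "'d::finite gam set" where
  "nonneg_orthant = {\<gamma>. \<forall>b\<in>Basis. 0 \<le> \<gamma> \<bullet> b}"

lemma convex_nonneg_orthant: "convex nonneg_orthant"
  by (auto simp: convex_def nonneg_orthant_def inner_add_left)

lemma coordinate_inner:
  fixes \<gamma> :: "'d::finite gam"
  shows "fst \<gamma> $ i = \<gamma> \<bullet> (axis i 1, 0, 0, 0)"
    and "fst (snd \<gamma>) $ i = \<gamma> \<bullet> (0, axis i 1, 0, 0)"
    and "fst (snd (snd \<gamma>)) $ i = \<gamma> \<bullet> (0, 0, axis i 1, 0)"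
    and "snd (snd (snd \<gamma>)) $ i = \<gamma> \<bullet> (0, 0, 0, axis i 1)"
  by (simp_all add: inner_prod_def inner_axis)

lemma coordinate_Basis:
  "(axis i 1, 0, 0, 0) \<in> (Basis :: 'd::finite gam set)"
  "(0, axis i 1, 0, 0) \<in> (Basis :: 'd::finite gam set)"
  "(0, 0, axis i 1, 0) \<in> (Basis :: 'd::finite gam set)"
  "(0, 0, 0, axis i 1) \<in> (Basis :: 'd::finite gam set)"
  by (auto simp: Basis_prod_def axis_in_Basis_iff image_iff zero_prod_def)

lemma nonneg_orthant_coordinates:
  assumes "\<gamma> \<in> nonneg_orthant"
  shows "0 \<le> fst \<gamma> $ i" "0 \<le> fst (snd \<gamma>) $ i"
    "0 \<le> fst (snd (snd \<gamma>)) $ i" "0 \<le> snd (snd (snd \<gamma>)) $ i"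
  using assms coordinate_Basis[of i] by (auto simp: coordinate_inner nonneg_orthant_def)

lemma linear_coordinates:
  "linear (\<lambda>\<gamma> :: 'd::finite gam. fst \<gamma> $ i)"
  "linear (\<lambda>\<gamma> :: 'd::finite gam. fst (snd \<gamma>) $ i)"
  "linear (\<lambda>\<gamma> :: 'd::finite gam. fst (snd (snd \<gamma>)) $ i)"
  "linear (\<lambda>\<gamma> :: 'd::finite gam. snd (snd (snd \<gamma>)) $ i)"
  by (auto intro!: linearI)

lemma real_polynomial_function_coordinates:
  "real_polynomial_function (\<lambda>\<gamma> :: 'd::finite gam. fst \<gamma> $ i)"
  "real_polynomial_function (\<lambda>\<gamma> :: 'd::finite gam. fst (snd \<gamma>) $ i)"
  "real_polynomial_function (\<lambda>\<gamma> :: 'd::finite gam. fst (snd (snd \<gamma>)) $ i)"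
  "real_polynomial_function (\<lambda>\<gamma> :: 'd::finite gam. snd (snd (snd \<gamma>)) $ i)"
  using linear_coordinates[of i]
  by (auto intro!: real_polynomial_function.intros(1) linear_conv_bounded_linear[THEN iffD1])

lemma C1_eq: "C1 \<gamma> = (\<Sum>i\<in>UNIV.
     1/6 * (fst \<gamma>$i + fst (snd \<gamma>)$i + snd (snd (snd \<gamma>))$i)^3
     + 1/2 * ((fst \<gamma>$i)^4 + (fst (snd \<gamma>)$i)^4 + (snd (snd (snd \<gamma>))$i)^4)
     + 1/2 * ((fst \<gamma>$i)^2 + (fst (snd \<gamma>)$i)^2 + (snd (snd (snd \<gamma>))$i)^2))"
  by (simp add: C1_def case_prod_beta)

lemma C2_eq: "C2 \<gamma> = (\<Sum>i\<in>UNIV.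
     1/6 * ((fst \<gamma>$i)^3 + (fst (snd \<gamma>)$i)^3 + (snd (snd (snd \<gamma>))$i)^3)
     + 1/4 * (((fst \<gamma>$i)^2 + fst (snd \<gamma>)$i)^2 + ((fst (snd \<gamma>)$i)^2 + snd (snd (snd \<gamma>))$i)^2
         + ((snd (snd (snd \<gamma>))$i)^2 + fst \<gamma>$i)^2)
     + 1/4 * ((fst \<gamma>$i + (fst (snd \<gamma>)$i)^2)^2 + (fst (snd \<gamma>)$i + (snd (snd (snd \<gamma>))$i)^2)^2
         + (snd (snd (snd \<gamma>))$i + (fst \<gamma>$i)^2)^2))"
  by (simp add: C2_def case_prod_beta)

lemma C1_minus_C2: "C1 (a, b, \<psi>, c) - C2 (a, b, \<psi>, c) = (\<Sum>i\<in>UNIV. a$i * b$i * c$i)"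
  unfolding C1_def C2_def prod.case sum_subtractf[symmetric]
  by (intro sum.cong refl) (simp add: field_simps power2_eq_square power3_eq_cube power4_eq_xxxx)

lemma D1_minus_D2: "D1 i (\<psi>o, \<theta>, \<psi>, \<omega>) - D2 i (\<psi>o, \<theta>, \<psi>, \<omega>) = \<psi>o$i * \<psi>$i"
  by (simp add: D1_def D2_def power2_eq_square field_simps)

lemma real_polynomial_function_C1: "real_polynomial_function C1"
  and real_polynomial_function_C2: "real_polynomial_function C2"
  unfolding C1_eq[abs_def] C2_eq[abs_def]
  by (intro real_polynomial_function_sum real_polynomial_function.intros(2-4)
      real_polynomial_function_power
      real_polynomial_function_coordinates finite)+

lemma convex_on_C1: "convex_on nonneg_orthant C1"
  and convex_on_C2: "convex_on nonneg_orthant C2"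
  unfolding C1_eq[abs_def] C2_eq[abs_def]
  by (intro convex_on_finite_sum convex_on_add convex_on_cmul convex_on_power
      convex_on_linear[OF linear_coordinates(1)] convex_on_linear[OF linear_coordinates(2)]
      convex_on_linear[OF linear_coordinates(4)] convex_nonneg_orthant finite
      add_nonneg_nonneg nonneg_orthant_coordinates zero_le_power; simp)+

lemma GDERIV_half_square:
  "GDERIV (\<lambda>\<gamma>. 1/2 * (\<gamma> \<bullet> w)\<^sup>2) p :> (p \<bullet> w) *\<^sub>R w"
  unfolding gderiv_def by (auto intro!: derivative_eq_intros)

text \<open>
  For the quadratic \<open>D1\<close> and \<open>D2\<close> the Taylor remainder is exact, which gives curvature
  bounds 2 and 1.  These exact values (rather than Frobenius norms) lead to the factor \<open>3/2\<close> in
  the violation of the constraint \<open>\<psi>\<^sup>o \<psi> = 1\<close> below, which is absorbed by the factor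
  \<open>2 (sqrt 2 + 1)\<close> of the rate constant.
\<close>

lemma bregman_D1:
  "bregman (D1 i) p q
     = 1/2 * ((fst (q - p) $ i) + (fst (snd (snd (q - p))) $ i))\<^sup>2"
proof -
  define w :: "'a gam" where "w = (axis i 1, 0, axis i 1, 0)"
  have w: "\<gamma> \<bullet> w = fst \<gamma> $ i + fst (snd (snd \<gamma>)) $ i" for \<gamma>
    by (simp add: w_def inner_prod_def inner_axis)
  have "D1 i = (\<lambda>\<gamma>. 1/2 * (\<gamma> \<bullet> w)\<^sup>2)"
    by (simp add: D1_def w case_prod_beta fun_eq_iff)
  moreover from this have "gradient (D1 i) p = (p \<bullet> w) *\<^sub>R w"
    using GDERIV_half_square[of w p] by (simp add: gradient_eqI)
  ultimately have "bregman (D1 i) p q = 1/2 * ((q - p) \<bullet> w)\<^sup>2"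
    by (simp add: bregman_def inner_diff inner_commute power2_eq_square field_simps)
  then show ?thesis by (simp add: w)
qed

lemma bregman_D2:
  "bregman (D2 i) p q
     = 1/2 * ((fst (q - p) $ i)\<^sup>2 + (fst (snd (snd (q - p))) $ i)\<^sup>2)"
proof -
  define u v :: "'a gam" where "u = (axis i 1, 0, 0, 0)" and "v = (0, 0, axis i 1, 0)"
  have uv: "\<gamma> \<bullet> u = fst \<gamma> $ i" "\<gamma> \<bullet> v = fst (snd (snd \<gamma>)) $ i" for \<gamma>
    by (simp_all add: u_def v_def inner_prod_def inner_axis)
  have "D2 i = (\<lambda>\<gamma>. 1/2 * (\<gamma> \<bullet> u)\<^sup>2 + 1/2 * (\<gamma> \<bullet> v)\<^sup>2)"
    by (simp add: D2_def uv case_prod_beta fun_eq_iff)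
  moreover from this have "gradient (D2 i) p = (p \<bullet> u) *\<^sub>R u + (p \<bullet> v) *\<^sub>R v"
    using GDERIV_add[OF GDERIV_half_square[of u p] GDERIV_half_square[of v p]]
    by (simp add: gradient_eqI)
  ultimately have "bregman (D2 i) p q = 1/2 * (((q - p) \<bullet> u)\<^sup>2 + ((q - p) \<bullet> v)\<^sup>2)"
    by (simp add: bregman_def inner_diff inner_add inner_commute power2_eq_square field_simps)
  then show ?thesis by (simp add: uv)
qed

lemma coordinate_squares_le_norm:
  fixes \<gamma> :: "'d::finite gam"
  shows "(fst \<gamma> $ i)\<^sup>2 + (fst (snd (snd \<gamma>)) $ i)\<^sup>2 \<le> (norm \<gamma>)\<^sup>2"
proof -
  have sq: "(x $ i)\<^sup>2 \<le> (norm x)\<^sup>2" for x :: "real^'d"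
    using component_le_norm_cart[of x i] by (metis abs_norm_cancel abs_le_square_iff)
  obtain a b c e where g: "\<gamma> = (a, b, c, e)" by (cases \<gamma>) auto
  have "(norm \<gamma>)\<^sup>2 = (norm a)\<^sup>2 + (norm b)\<^sup>2 + (norm c)\<^sup>2 + (norm e)\<^sup>2"
    by (simp add: g norm_Pair)
  then show ?thesis
    using sq[of a] sq[of c] zero_le_power2[of "norm b"] zero_le_power2[of "norm e"]
    unfolding g fst_conv snd_conv by linarith
qed

lemma smooth_convex_on_D1: "smooth_convex_on C 2 (D1 i)"
  unfolding smooth_convex_on_def bregman_D1
proof (intro ballI conjI)
  fix p q :: "'a gam"
  have "(x + y)\<^sup>2 \<le> 2 * (x\<^sup>2 + y\<^sup>2)" for x y :: real
    using sum_squares_bound[of x y] by (simp add: power2_sum)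
  from order_trans[OF this mult_left_mono[OF coordinate_squares_le_norm], of "q - p" i]
  show "1/2 * (fst (q - p) $ i + fst (snd (snd (q - p))) $ i)\<^sup>2 \<le> 2/2 * (dist p q)\<^sup>2"
    unfolding dist_norm norm_minus_commute[of p q] by (simp add: mult.commute)
qed simp

lemma smooth_convex_on_D2: "smooth_convex_on C 1 (D2 i)"
  unfolding smooth_convex_on_def bregman_D2
proof (intro ballI conjI)
  fix p q :: "'a gam"
  show "1/2 * ((fst (q - p) $ i)\<^sup>2 + (fst (snd (snd (q - p))) $ i)\<^sup>2) \<le> 1/2 * (dist p q)\<^sup>2"
    unfolding dist_norm norm_minus_commute[of p q]
    by (intro mult_left_mono coordinate_squares_le_norm) simp
qed simp

lemma smooth_convex_on_polynomial:
  assumes F: "real_polynomial_function F" "convex_on C F"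
    and K: "\<And>z. z \<in> C \<Longrightarrow> hessian_frobenius F z \<le> K"
  shows "smooth_convex_on C K F"
  unfolding smooth_convex_on_def
  using bregman_nonneg[OF F] bregman_le_hessian_frobenius[OF F(1) convex_on_imp_convex[OF F(2)] _ _ K]
  by blast

section \<open>Simplices given by vertex lists\<close>

lemma barycentric_in_hull:
  fixes S :: "'a::real_vector list"
  assumes "\<And>j. j < length S \<Longrightarrow> 0 \<le> l j" "(\<Sum>j<length S. l j) = (1::real)"
  shows "(\<Sum>j<length S. l j *\<^sub>R S ! j) \<in> convex hull set S"
  by (rule convex_sum) (use assms in \<open>auto intro: hull_inc\<close>)

text \<open>
  Weights are indexed by positions in the vertex list, not by points, because a vertex list may
  have repetitions when the initial simplex is a single point.
\<close>

lemma hull_barycentric: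
  fixes S :: "'a::real_vector list"
  assumes "x \<in> convex hull set S"
  obtains l :: "nat \<Rightarrow> real" where "\<And>j. j < length S \<Longrightarrow> 0 \<le> l j" "(\<Sum>j<length S. l j) = 1"
    "x = (\<Sum>j<length S. l j *\<^sub>R S ! j)"
proof -
  let ?B = "{x. \<exists>l::nat \<Rightarrow> real. (\<forall>j<length S. 0 \<le> l j) \<and> (\<Sum>j<length S. l j) = 1
    \<and> x = (\<Sum>j<length S. l j *\<^sub>R S ! j)}"
  have "convex hull set S \<subseteq> ?B"
  proof (rule hull_minimal)
    show "set S \<subseteq> ?B"
    proof
      fix x assume "x \<in> set S"
      then obtain k where k: "k < length S" "x = S ! k" by (auto simp: in_set_conv_nth)
      have eq: "(\<Sum>j<length S. (if j = k then 1 else 0::real) *\<^sub>R S ! j)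
          = (\<Sum>j<length S. if j = k then S ! j else 0)"
        by (intro sum.cong) auto
      show "x \<in> ?B"
        by (rule CollectI, rule exI[of _ "\<lambda>j. if j = k then 1 else 0"])
          (use k in \<open>simp add: eq sum.delta'\<close>)
    qed
    show "convex ?B"
      unfolding convex_def
    proof (intro ballI allI impI)
      fix x y and u v :: real
      assume "x \<in> ?B" "y \<in> ?B" and uv: "0 \<le> u" "0 \<le> v" "u + v = 1"
      then obtain k l :: "nat \<Rightarrow> real"
        where k: "\<forall>j<length S. 0 \<le> k j" "(\<Sum>j<length S. k j) = 1" "x = (\<Sum>j<length S. k j *\<^sub>R S ! j)"
          and l: "\<forall>j<length S. 0 \<le> l j" "(\<Sum>j<length S. l j) = 1" "y = (\<Sum>j<length S. l j *\<^sub>R S ! j)"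
        by auto
      show "u *\<^sub>R x + v *\<^sub>R y \<in> ?B"
        by (rule CollectI, rule exI[of _ "\<lambda>j. u * k j + v * l j"])
          (use k l uv in \<open>auto simp: sum.distrib sum_distrib_left[symmetric] scaleR_sum_right
             algebra_simps\<close>)
    qed
  qed
  with assms have "x \<in> ?B" by auto
  then show ?thesis using that by auto
qed

text \<open>
  The two situations in which the secant value is well defined.  The second one is needed: if the
  only feasible point has all \<open>\<psi>\<^sub>i\<close> equal, the inequality behind the choice of \<open>alpha\<close> is an
  equality and the initial simplex collapses to this point.
\<close>

definition simplex_or_point :: "'a::real_vector list \<Rightarrow> bool" where
  "simplex_or_point S \<longleftrightarrow>
     (\<forall>l::nat \<Rightarrow> real. (\<Sum>j<length S. l j) = 0 \<and> (\<Sum>j<length S. l j *\<^sub>R S ! j) = 0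
        \<longrightarrow> (\<forall>j<length S. l j = 0))
     \<or> (\<forall>j<length S. \<forall>k<length S. S ! j = S ! k)"

lemma sec_approx_barycentric:
  assumes S: "simplex_or_point S" and l: "(\<Sum>j<length S. l j) = 1" "\<gamma> = (\<Sum>j<length S. l j *\<^sub>R S ! j)"
  shows "sec_approx S F \<gamma> = (\<Sum>j<length S. l j * F (S ! j))"
  unfolding sec_approx_def
proof (rule the_equality)
  fix v assume "\<exists>k. (\<Sum>j<length S. k j) = 1 \<and> \<gamma> = (\<Sum>j<length S. k j *\<^sub>R S ! j) \<and>
     v = (\<Sum>j<length S. k j * F (S ! j))"
  then obtain k where k: "(\<Sum>j<length S. k j) = 1" "\<gamma> = (\<Sum>j<length S. k j *\<^sub>R S ! j)"
     and v: "v = (\<Sum>j<length S. k j * F (S ! j))" by auto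
  from S show "v = (\<Sum>j<length S. l j * F (S ! j))"
    unfolding simplex_or_point_def
  proof
    assume "\<forall>l. (\<Sum>j<length S. l j) = 0 \<and> (\<Sum>j<length S. l j *\<^sub>R S ! j) = 0
        \<longrightarrow> (\<forall>j<length S. l j = 0)"
    moreover have "(\<Sum>j<length S. k j - l j) = 0" "(\<Sum>j<length S. (k j - l j) *\<^sub>R S ! j) = 0"
      using k l by (simp_all add: sum_subtractf scaleR_diff_left)
    ultimately have "\<forall>j<length S. k j - l j = 0"
      by (metis (no_types, lifting) sum.cong)
    then show ?thesis by (simp add: v)
  next
    assume eq: "\<forall>j<length S. \<forall>k<length S. S ! j = S ! k"
    have "(\<Sum>j<length S. m j * F (S ! j)) = F (S ! 0)" if "(\<Sum>j<length S. m j) = 1" for m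
    proof -
      have "(\<Sum>j<length S. m j * F (S ! j)) = (\<Sum>j<length S. m j * F (S ! 0))"
        using eq by (intro sum.cong refl) (metis gr_zeroI lessThan_iff not_less_zero)
      then show ?thesis using that by (simp add: sum_distrib_right[symmetric])
    qed
    then show ?thesis by (simp add: v k l)
  qed
qed (use l in auto)

text \<open>
  Squared lengths are used because the bound on the new edges of a bisection is an inequality of
  squares, and because the error estimates are quadratic.
\<close>

definition edges_sq_le :: "'a::metric_space list \<Rightarrow> real \<Rightarrow> bool" where
  "edges_sq_le S c \<longleftrightarrow> (\<forall>p<length S. \<forall>q<length S. (dist (S ! p) (S ! q))\<^sup>2 \<le> c)"

text \<open>
  A simplex has the diameter of its vertex set: a ball around a point that contains all vertices
  contains their hull.  This is applied first with a vertex and then with an arbitrary point as the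
  centre.
\<close>

lemma hull_dist_sq_le:
  fixes S :: "'a::real_inner list"
  assumes S: "edges_sq_le S c" and xy: "x \<in> convex hull set S" "y \<in> convex hull set S"
  shows "(dist x y)\<^sup>2 \<le> c"
proof -
  have ve: "dist u v \<le> sqrt c" if "u \<in> set S" "v \<in> set S" for u v
    using S that by (force simp: edges_sq_le_def in_set_conv_nth intro: real_le_rsqrt)
  have cb: "convex hull set S \<subseteq> cball v (sqrt c)" if "v \<in> set S" for v
    by (rule hull_minimal) (use ve[OF that] in auto)
  then have "dist x v \<le> sqrt c" if "v \<in> set S" for v
    using cb[OF that] xy(1) by (metis dist_commute mem_cball subsetD)
  then have "convex hull set S \<subseteq> cball x (sqrt c)"
    by (intro hull_minimal) auto
  with xy have "dist x y \<le> sqrt c" by auto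
  moreover have "0 \<le> c"
  proof -
    have "S \<noteq> []" using xy by auto
    then show ?thesis using S by (auto simp: edges_sq_le_def dest!: spec[of _ 0])
  qed
  ultimately show ?thesis by (metis real_sqrt_pow2 power_mono zero_le_dist)
qed

lemma tan_approx_error:
  assumes F: "smooth_convex_on (hull_of S) K F" and "edges_sq_le S c" "0 \<le> K"
    and tp: "tp S F \<in> hull_of S" and g: "\<gamma> \<in> hull_of S"
  shows "tan_approx tp S F \<gamma> \<le> F \<gamma>" "F \<gamma> - tan_approx tp S F \<gamma> \<le> K / 2 * c"
proof -
  have "F \<gamma> - tan_approx tp S F \<gamma> = bregman F (tp S F) \<gamma>"
    by (simp add: tan_approx_def bregman_def)
  moreover have "0 \<le> bregman F (tp S F) \<gamma>"
      "bregman F (tp S F) \<gamma> \<le> K / 2 * (dist (tp S F) \<gamma>)\<^sup>2"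
    using F tp g by (auto simp: smooth_convex_on_def)
  moreover have "K / 2 * (dist (tp S F) \<gamma>)\<^sup>2 \<le> K / 2 * c"
    using assms hull_dist_sq_le[of S c] by (intro mult_left_mono) auto
  ultimately show "tan_approx tp S F \<gamma> \<le> F \<gamma>" "F \<gamma> - tan_approx tp S F \<gamma> \<le> K / 2 * c"
    by linarith+
qed

text \<open>
  With barycentric weights \<open>l\<close> of \<open>\<gamma>\<close>, the secant error is the \<open>l\<close>-average of the Bregman
  divergences from \<open>\<gamma>\<close> to the vertices, since the linear terms average to zero.
\<close>

lemma sec_approx_error:
  assumes F: "smooth_convex_on (hull_of S) K F" and "edges_sq_le S c" "0 \<le> K"
    and S: "simplex_or_point S" and g: "\<gamma> \<in> hull_of S"
  shows "F \<gamma> \<le> sec_approx S F \<gamma>" "sec_approx S F \<gamma> - F \<gamma> \<le> K / 2 * c"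
proof -
  obtain l where l: "\<And>j. j < length S \<Longrightarrow> 0 \<le> l j" "(\<Sum>j<length S. l j) = 1"
    "\<gamma> = (\<Sum>j<length S. l j *\<^sub>R S ! j)"
    using g by (rule hull_barycentric) blast
  have "(\<Sum>j<length S. l j * bregman F \<gamma> (S ! j))
      = (\<Sum>j<length S. l j * F (S ! j)) - (\<Sum>j<length S. l j) * F \<gamma>
        - gradient F \<gamma> \<bullet> ((\<Sum>j<length S. l j *\<^sub>R S ! j) - (\<Sum>j<length S. l j) *\<^sub>R \<gamma>)"
    by (simp add: bregman_def algebra_simps sum_subtractf sum.distrib inner_sum_right
        inner_diff_right sum_distrib_left sum_distrib_right scaleR_sum_left)
  then have eq: "sec_approx S F \<gamma> - F \<gamma> = (\<Sum>j<length S. l j * bregman F \<gamma> (S ! j))"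
    unfolding sec_approx_barycentric[OF S l(2,3)] l(2) l(3)[symmetric] by simp
  have br: "0 \<le> bregman F \<gamma> (S ! j)" "bregman F \<gamma> (S ! j) \<le> K / 2 * c" if "j < length S" for j
  proof -
    have v: "S ! j \<in> hull_of S" using that by (auto intro: hull_inc)
    show "0 \<le> bregman F \<gamma> (S ! j)" using F g v by (auto simp: smooth_convex_on_def)
    have "bregman F \<gamma> (S ! j) \<le> K / 2 * (dist \<gamma> (S ! j))\<^sup>2"
      using F g v by (auto simp: smooth_convex_on_def)
    also have "\<dots> \<le> K / 2 * c"
      using assms hull_dist_sq_le[of S c] v by (intro mult_left_mono) auto
    finally show "bregman F \<gamma> (S ! j) \<le> K / 2 * c" .
  qed
  have "0 \<le> (\<Sum>j<length S. l j * bregman F \<gamma> (S ! j))"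
    using l br by (intro sum_nonneg mult_nonneg_nonneg) auto
  with eq show "F \<gamma> \<le> sec_approx S F \<gamma>" by linarith
  have "(\<Sum>j<length S. l j * bregman F \<gamma> (S ! j)) \<le> (\<Sum>j<length S. l j * (K / 2 * c))"
    using l br by (intro sum_mono mult_left_mono) auto
  also have "\<dots> = K / 2 * c" using l by (simp only: sum_distrib_right[symmetric])
  finally show "sec_approx S F \<gamma> - F \<gamma> \<le> K / 2 * c" using eq by linarith
qed

section \<open>Longest-edge bisection\<close>

definition bisection_child :: "'a::real_normed_vector list \<Rightarrow> 'a list \<Rightarrow> bool" where
  "bisection_child S T \<longleftrightarrow> (\<exists>i<length S. \<exists>j<length S. i \<noteq> j \<and>
     (\<forall>p<length S. \<forall>q<length S. dist (S ! p) (S ! q) \<le> dist (S ! i) (S ! j)) \<and>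
     T = S[i := midpoint (S ! i) (S ! j)])"

lemma longest_edge_bisection_children:
  assumes "longest_edge_bisection S T T'"
  shows "bisection_child S T" "bisection_child S T'"
  using assms unfolding longest_edge_bisection_def bisection_child_def
  by (metis, metis dist_commute midpoint_sym)

lemma bisection_child_length: "bisection_child S T \<Longrightarrow> length T = length S"
  by (auto simp: bisection_child_def)

lemma bisection_child_hull:
  assumes "bisection_child S T"
  shows "convex hull set T \<subseteq> convex hull set S"
proof (rule hull_minimal)
  from assms obtain i j where ij: "i < length S" "j < length S"
    and T: "T = S[i := midpoint (S ! i) (S ! j)]" by (auto simp: bisection_child_def)
  have "closed_segment (S ! i) (S ! j) \<subseteq> convex hull set S"
    using ij by (intro closed_segment_subset) (auto intro: hull_inc)
  then have "midpoint (S ! i) (S ! j) \<in> convex hull set S" by auto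
  then show "set T \<subseteq> convex hull set S"
    unfolding T using set_update_subset_insert[of S i] by (auto intro: hull_inc)
qed auto

text \<open>
  A combination of the vertices of the child is a combination of the vertices of the parent, where
  the weight of the midpoint is shared equally by the two endpoints of the bisected edge.  Both the
  nondegeneracy of the children and the fact that they cover the parent follow from reading this
  correspondence of weights in one or the other direction.
\<close>

lemma barycentric_midpoint_shift:
  fixes S :: "'a::real_vector list"
  assumes ij: "i < length S" "j < length S" "i \<noteq> j"
  shows "(\<Sum>p<length S. l p *\<^sub>R (S[i := midpoint (S ! i) (S ! j)] ! p))
     = (\<Sum>p<length S. (l(i := l i / 2, j := l j + l i / 2)) p *\<^sub>R S ! p)"
    and "(\<Sum>p<length S. (l(i := l i / 2, j := l j + l i / 2)) p) = (\<Sum>p<length S. l p)"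
proof -
  let ?R = "{..<length S} - {i} - {j}"
  have split: "(\<Sum>p<length S. g p) = g i + (g j + (\<Sum>p\<in>?R. g p))" for g :: "nat \<Rightarrow> 'b::comm_monoid_add"
    using ij by (simp add: sum.remove[of _ i] sum.remove[of _ j])
  show "(\<Sum>p<length S. (l(i := l i / 2, j := l j + l i / 2)) p) = (\<Sum>p<length S. l p)"
    unfolding split using ij by (simp add: fun_upd_other)
  show "(\<Sum>p<length S. l p *\<^sub>R (S[i := midpoint (S ! i) (S ! j)] ! p))
     = (\<Sum>p<length S. (l(i := l i / 2, j := l j + l i / 2)) p *\<^sub>R S ! p)"
    unfolding split using ij
    by (simp add: midpoint_def scaleR_add_left scaleR_add_right add.assoc)
qed

lemma bisection_child_simplex_or_point:
  assumes child: "bisection_child S T" and S: "simplex_or_point S"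
  shows "simplex_or_point T"
proof -
  from child obtain i j where ij: "i < length S" "j < length S" "i \<noteq> j"
    and T: "T = S[i := midpoint (S ! i) (S ! j)]" by (auto simp: bisection_child_def)
  from S show ?thesis unfolding simplex_or_point_def[of S]
  proof
    assume *: "\<forall>l. (\<Sum>j<length S. l j) = 0 \<and> (\<Sum>j<length S. l j *\<^sub>R S ! j) = 0
        \<longrightarrow> (\<forall>j<length S. l j = 0)"
    have "\<forall>p<length T. l p = 0"
      if "(\<Sum>p<length T. l p) = 0" "(\<Sum>p<length T. l p *\<^sub>R T ! p) = 0" for l :: "nat \<Rightarrow> real"
    proof -
      let ?l = "l(i := l i / 2, j := l j + l i / 2)"
      have "(\<Sum>p<length S. ?l p) = 0" "(\<Sum>p<length S. ?l p *\<^sub>R S ! p) = 0"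
        using that barycentric_midpoint_shift[OF ij, of l] by (simp_all add: T)
      with * have z: "?l p = 0" if "p < length S" for p using that by blast
      have "l p = 0" if "p < length S" for p
        using z[of p] z[of i] z[of j] ij that by (auto split: if_splits)
      then show ?thesis by (simp add: T)
    qed
    then show ?thesis by (auto simp: simplex_or_point_def)
  next
    assume eq: "\<forall>j<length S. \<forall>k<length S. S ! j = S ! k"
    then have "S ! j = S ! i" using ij by blast
    then have "T = S" by (simp add: T)
    with S show ?thesis by simp
  qed
qed

lemma longest_edge_bisection_covers:
  assumes "longest_edge_bisection S T T'"
  shows "hull_of S \<subseteq> hull_of T \<union> hull_of T'"
proof
  fix x assume "x \<in> hull_of S"
  then obtain l where l: "\<And>p. p < length S \<Longrightarrow> 0 \<le> l p" "(\<Sum>p<length S. l p) = 1"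
    "x = (\<Sum>p<length S. l p *\<^sub>R S ! p)"
    by (rule hull_barycentric) blast
  from assms obtain i j where ij: "i < length S" "j < length S" "i \<noteq> j"
    and T: "T = S[i := midpoint (S ! i) (S ! j)]" "T' = S[j := midpoint (S ! j) (S ! i)]"
    unfolding longest_edge_bisection_def by (metis midpoint_sym)
  \<comment> \<open>\<open>x\<close> lies in the child that drops the endpoint of smaller weight: doubling that weight and
    reducing the other one undoes the sharing of the weight of the midpoint\<close>
  have *: "x \<in> hull_of (S[a := midpoint (S ! a) (S ! b)])"
    if ab: "a < length S" "b < length S" "a \<noteq> b" and le: "l a \<le> l b" for a b
  proof -
    let ?k = "l(a := 2 * l a, b := l b - l a)"
    have k: "?k(a := ?k a / 2, b := ?k b + ?k a / 2) = l" using ab by (auto simp: fun_eq_iff)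
    have "x = (\<Sum>p<length S. ?k p *\<^sub>R (S[a := midpoint (S ! a) (S ! b)] ! p))"
      "(\<Sum>p<length S. ?k p) = 1"
      using barycentric_midpoint_shift[OF ab, of ?k] l unfolding k by simp_all
    then show ?thesis
      using barycentric_in_hull[of "S[a := midpoint (S ! a) (S ! b)]" ?k] l(1) ab le by auto
  qed
  show "x \<in> hull_of T \<union> hull_of T'"
    using *[of i j] *[of j i] ij T by (metis UnI1 UnI2 linorder_le_cases)
qed

text \<open>
  The formula for the length of a median of a triangle.
\<close>

lemma dist_midpoint_sq:
  fixes a b w :: "'a::real_inner"
  shows "(dist (midpoint a b) w)\<^sup>2 = ((dist w a)\<^sup>2 + (dist w b)\<^sup>2) / 2 - (dist a b)\<^sup>2 / 4"
proof -
  have m: "midpoint a b - w = (1/2) *\<^sub>R ((a - w) + (b - w))"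
    by (simp add: midpoint_def algebra_simps scaleR_2[symmetric])
  have ab: "a - b = (a - w) - (b - w)" by simp
  show ?thesis
    unfolding dist_norm m ab norm_minus_commute[of w]
    by (simp only: power2_norm_eq_inner) (simp add: field_simps inner_simps inner_commute)
qed

lemma midpoint_dist_sq_le:
  fixes a b w :: "'a::real_inner"
  assumes "dist w a \<le> dist a b" "dist w b \<le> dist a b"
  shows "(dist (midpoint a b) w)\<^sup>2 \<le> 3/4 * (dist a b)\<^sup>2"
proof -
  have "(dist w a)\<^sup>2 \<le> (dist a b)\<^sup>2" "(dist w b)\<^sup>2 \<le> (dist a b)\<^sup>2"
    using assms by (auto intro: power_mono)
  moreover have "(A + B) / 2 - D / 4 \<le> 3/4 * D" if "A \<le> D" "B \<le> D" for A B D :: real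
    using that by (simp add: field_simps)
  ultimately show ?thesis unfolding dist_midpoint_sq by blast
qed

text \<open>
  This is one step of Kearfott's argument.  All edges have squared length at most \<open>c\<close>, and call an
  edge short if its squared length is at most \<open>3/4 c\<close>.  The set of old vertices is such that every
  edge with an endpoint outside it is short.  The midpoint of a longest edge has only short edges, by
  the formula for medians.  So if an old vertex is replaced, the old set can shrink by one.  If the
  replaced vertex is not old, then the longest edge was short, hence all edges are, and the old set can
  be emptied.
\<close>

lemma bisection_child_old_vertices:
  fixes S :: "'a::real_inner list"
  assumes child: "bisection_child S T" and c: "edges_sq_le S c"
    and Old: "finite Old" "\<And>p q. p < length S \<Longrightarrow> q < length S \<Longrightarrow> p \<notin> Old \<or> q \<notin> Old \<Longrightarrow>
       (dist (S ! p) (S ! q))\<^sup>2 \<le> 3/4 * c"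
  obtains New where "finite New" "card New \<le> card Old - 1" "edges_sq_le T c"
    "\<And>p q. p < length T \<Longrightarrow> q < length T \<Longrightarrow> p \<notin> New \<or> q \<notin> New \<Longrightarrow>
       (dist (T ! p) (T ! q))\<^sup>2 \<le> 3/4 * c"
proof -
  from child obtain i j where ij: "i < length S" "j < length S" "i \<noteq> j"
    and longest: "\<And>p q. p < length S \<Longrightarrow> q < length S \<Longrightarrow> dist (S ! p) (S ! q) \<le> dist (S ! i) (S ! j)"
    and T: "T = S[i := midpoint (S ! i) (S ! j)]" by (auto simp: bisection_child_def)
  have lc: "(dist (S ! i) (S ! j))\<^sup>2 \<le> c" using c ij by (auto simp: edges_sq_le_def)
  have c0: "0 \<le> c" using lc by (meson order_trans zero_le_power2)
  have mid: "(dist (T ! i) (T ! q))\<^sup>2 \<le> 3/4 * (dist (S ! i) (S ! j))\<^sup>2" if "q < length S" for q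
  proof (cases "q = i")
    case False
    then show ?thesis
      using ij that midpoint_dist_sq_le[OF longest[of q i] longest[of q j]] by (simp add: T)
  qed simp
  have mid': "(dist (T ! q) (T ! i))\<^sup>2 \<le> 3/4 * (dist (S ! i) (S ! j))\<^sup>2" if "q < length S" for q
    using mid[OF that] by (simp add: dist_commute)
  have midc: "(dist (T ! i) (T ! q))\<^sup>2 \<le> 3/4 * c" "(dist (T ! q) (T ! i))\<^sup>2 \<le> 3/4 * c"
    if "q < length S" for q
    using mid[OF that] mid'[OF that] lc by linarith+
  have Tc: "edges_sq_le T c"
    unfolding edges_sq_le_def
  proof (intro allI impI)
    fix p q assume pq: "p < length T" "q < length T"
    then have pq: "p < length S" "q < length S" by (simp_all add: T)
    consider "p = i" | "q = i" | "p \<noteq> i" "q \<noteq> i" by blast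
    then show "(dist (T ! p) (T ! q))\<^sup>2 \<le> c"
    proof cases
      case 1 show ?thesis unfolding 1 using midc(1)[OF pq(2)] c0 by linarith
    next
      case 2 show ?thesis unfolding 2 using midc(2)[OF pq(1)] c0 by linarith
    next
      case 3 then show ?thesis using c pq by (auto simp: T edges_sq_le_def)
    qed
  qed
  show thesis
  proof (cases "i \<in> Old")
    case True
    show thesis
    proof (rule that[OF _ _ Tc])
      show "finite (Old - {i})" "card (Old - {i}) \<le> card Old - 1" using Old True by auto
      fix p q assume pq: "p < length T" "q < length T" "p \<notin> Old - {i} \<or> q \<notin> Old - {i}"
      then have pq': "p < length S" "q < length S" by (simp_all add: T)
      show "(dist (T ! p) (T ! q))\<^sup>2 \<le> 3/4 * c"
        using midc(1)[OF pq'(2)] midc(2)[OF pq'(1)] pq(3) Old(2)[OF pq']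
        by (cases "p = i"; cases "q = i") (auto simp: T)
    qed
  next
    case False
    then have small: "(dist (S ! i) (S ! j))\<^sup>2 \<le> 3/4 * c" using Old(2) ij by blast
    show thesis
    proof (rule that[OF _ _ Tc, of "{}"])
      fix p q assume pq: "p < length T" "q < length T"
      then have pq: "p < length S" "q < length S" by (simp_all add: T)
      have "(dist (S ! p) (S ! q))\<^sup>2 \<le> (dist (S ! i) (S ! j))\<^sup>2"
        using longest[OF pq] by (intro power_mono) auto
      with small have "(dist (S ! p) (S ! q))\<^sup>2 \<le> 3/4 * c" by linarith
      then show "(dist (T ! p) (T ! q))\<^sup>2 \<le> 3/4 * c"
        using midc(1)[OF pq(2)] midc(2)[OF pq(1)]
        by (cases "p = i"; cases "q = i") (auto simp: T)
    qed auto
  qed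
qed

lemma edges_sq_le_child:
  fixes S :: "'a::real_inner list"
  assumes "bisection_child S T" "edges_sq_le S c"
  shows "edges_sq_le T c"
  by (rule bisection_child_old_vertices[OF assms, of "{..<length S}"]) auto

text \<open>
  The \<open>m + 1\<close> vertices are all old at the start.  After \<open>m\<close> steps at most one old vertex remains,
  and there is no edge between two different old vertices.
\<close>

lemma bisection_round:
  fixes R :: "nat \<Rightarrow> 'a::real_inner list"
  assumes len: "length (R 0) = Suc m" and child: "\<And>t. t < m \<Longrightarrow> bisection_child (R t) (R (Suc t))"
    and c: "edges_sq_le (R 0) c"
  shows "edges_sq_le (R m) (3/4 * c)"
proof -
  have "\<exists>Old. finite Old \<and> card Old \<le> Suc m - t \<and> length (R t) = Suc m \<and> edges_sq_le (R t) c \<and>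
      (\<forall>p<length (R t). \<forall>q<length (R t). p \<notin> Old \<or> q \<notin> Old \<longrightarrow>
         (dist (R t ! p) (R t ! q))\<^sup>2 \<le> 3/4 * c)" if "t \<le> m" for t
    using that
  proof (induction t)
    case 0
    show ?case by (rule exI[of _ "{..<Suc m}"]) (use len c in auto)
  next
    case (Suc t)
    then obtain Old where Old: "finite Old" "card Old \<le> Suc m - t" "length (R t) = Suc m"
      "edges_sq_le (R t) c"
      "\<And>p q. p < length (R t) \<Longrightarrow> q < length (R t) \<Longrightarrow> p \<notin> Old \<or> q \<notin> Old \<Longrightarrow>
         (dist (R t ! p) (R t ! q))\<^sup>2 \<le> 3/4 * c" by auto
    have ch: "bisection_child (R t) (R (Suc t))" using child Suc.prems by simp
    obtain New where "finite New" "card New \<le> card Old - 1" "edges_sq_le (R (Suc t)) c"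
      "\<And>p q. p < length (R (Suc t)) \<Longrightarrow> q < length (R (Suc t)) \<Longrightarrow> p \<notin> New \<or> q \<notin> New \<Longrightarrow>
         (dist (R (Suc t) ! p) (R (Suc t) ! q))\<^sup>2 \<le> 3/4 * c"
      by (rule bisection_child_old_vertices[OF ch Old(4,1,5)]) auto
    with Old bisection_child_length[OF ch] show ?case
      by (intro exI[of _ New]) auto
  qed
  from this[of m] obtain Old where Old: "finite Old" "card Old \<le> 1" "edges_sq_le (R m) c"
    "length (R m) = Suc m"
    "\<And>p q. p < length (R m) \<Longrightarrow> q < length (R m) \<Longrightarrow> p \<notin> Old \<or> q \<notin> Old \<Longrightarrow>
         (dist (R m ! p) (R m ! q))\<^sup>2 \<le> 3/4 * c" by auto
  have "0 \<le> c" using Old(3,4) by (auto simp: edges_sq_le_def dest!: spec[of _ 0])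
  show ?thesis unfolding edges_sq_le_def
  proof (intro allI impI)
    fix p q assume pq: "p < length (R m)" "q < length (R m)"
    show "(dist (R m ! p) (R m ! q))\<^sup>2 \<le> 3/4 * c"
    proof (cases "p \<in> Old \<and> q \<in> Old")
      case True
      then have "p = q" using Old(1,2) card_le_Suc0_iff_eq by auto
      then show ?thesis using \<open>0 \<le> c\<close> by simp
    qed (use Old(5) pq in blast)
  qed
qed

lemma nested_bisections_edges:
  fixes R :: "nat \<Rightarrow> 'a::real_inner list"
  assumes len: "length (R 0) = Suc m" and m: "0 < m"
    and child: "\<And>t. t < N \<Longrightarrow> bisection_child (R t) (R (Suc t))"
    and c: "edges_sq_le (R 0) c"
  shows "edges_sq_le (R N) ((3/4) ^ (N div m) * c)"
  using len child c
proof (induction N arbitrary: R c rule: less_induct)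
  case (less N)
  show ?case
  proof (cases "N < m")
    case True
    have "edges_sq_le (R t) c" if "t \<le> N" for t
      using that
    proof (induction t)
      case (Suc t)
      then show ?case
        using edges_sq_le_child[OF less.prems(2)[of t]] by simp
    qed (use less.prems in simp)
    with True show ?thesis by simp
  next
    case False
    define R' where "R' t = R (t + m)" for t
    have "length (R t) = Suc m" if "t \<le> N" for t
      using that
    proof (induction t)
      case (Suc t)
      then show ?case
        using bisection_child_length[OF less.prems(2)[of t]] by simp
    qed (use less.prems in simp)
    then have "length (R' 0) = Suc m" using False by (simp add: R'_def)
    moreover have "bisection_child (R' t) (R' (Suc t))" if "t < N - m" for t
      using less.prems(2)[of "t + m"] that by (simp add: R'_def)
    moreover have "edges_sq_le (R' 0) (3/4 * c)"
      using bisection_round[of R m c] less.prems False by (simp add: R'_def)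
    ultimately have "edges_sq_le (R' (N - m)) ((3/4) ^ ((N - m) div m) * (3/4 * c))"
      using m False by (intro less.IH) auto
    moreover have "N div m = Suc ((N - m) div m)" using m False by (simp add: le_div_geq)
    ultimately show ?thesis using False by (simp add: R'_def mult_ac)
  qed
qed

section \<open>The feasible region and the initial simplex\<close>

lemma sum_inner_Basis_prod:
  fixes \<gamma> :: "'a::euclidean_space \<times> 'b::euclidean_space"
  shows "(\<Sum>b\<in>Basis. \<gamma> \<bullet> b) = (\<Sum>b\<in>Basis. fst \<gamma> \<bullet> b) + (\<Sum>b\<in>Basis. snd \<gamma> \<bullet> b)"
proof -
  have "inj_on (\<lambda>u. (u, 0) :: 'a \<times> 'b) Basis" "inj_on (\<lambda>v. (0, v) :: 'a \<times> 'b) Basis"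
    by (auto intro: inj_onI)
  moreover have "(\<lambda>u. (u, 0)) ` Basis \<inter> (\<lambda>v. (0, v)) ` Basis = ({} :: ('a \<times> 'b) set)"
    by auto
  ultimately show ?thesis
    unfolding Basis_prod_def
    by (subst sum.union_disjoint) (auto simp: sum.reindex inner_prod_def)
qed

lemma Basis_real_vec: "(Basis :: (real^'n::finite) set) = range (\<lambda>i. axis i 1)"
  by (auto simp: Basis_vec_def)

lemma sum_inner_Basis_real_vec: "(\<Sum>b\<in>Basis. x \<bullet> b) = (\<Sum>i\<in>UNIV. (x :: real^'n::finite) $ i)"
proof -
  have "inj (\<lambda>i. axis i 1 :: real^'n)" by (auto intro!: injI simp: axis_eq_axis)
  then show ?thesis by (simp add: Basis_real_vec sum.reindex inner_axis)
qed

lemma nonneg_orthantI: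
  assumes "\<And>i. 0 \<le> a $ i" "\<And>i. 0 \<le> b $ i" "\<And>i. 0 \<le> c $ i" "\<And>i. 0 \<le> e $ i"
  shows "(a, b, c, e) \<in> (nonneg_orthant :: 'd::finite gam set)"
  using assms by (auto simp: nonneg_orthant_def Basis_prod_def Basis_real_vec inner_axis)

text \<open>
  The properties of the data on which the analysis of the algorithm rests.  The inequality
  \<open>f(X=x) + f(X\<noteq>x) \<le> 1\<close> justifies the summand 1 in the definition of \<open>alpha\<close>.
\<close>

locale bounded_program =
  fixes D :: "('w::finite, 'd::finite) known_data" and \<delta> :: real
  assumes IR_Phi_nonempty: "IR_Phi D \<noteq> {}"
    and delta_pos: "0 < \<delta>"
    and delta_le: "(\<theta>, \<psi>, \<omega>) \<in> IR_Phi D \<Longrightarrow> \<delta> \<le> \<psi> $ i"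
    and fx_fnx: "fx D + fnx D \<le> 1"
begin

lemma IR_Phi_dest:
  assumes "(\<theta>, \<psi>, \<omega>) \<in> IR_Phi D"
  shows "(\<Sum>i\<in>UNIV. \<theta> $ i) = fyx D" "(\<Sum>i\<in>UNIV. \<psi> $ i) = fx D" "(\<Sum>i\<in>UNIV. \<omega> $ i) = fnx D"
    and "0 \<le> \<theta> $ i" "0 < \<psi> $ i" "\<psi> $ i \<le> fx D" "0 \<le> \<omega> $ i"
  using assms by (auto simp: IR_Phi_def)

lemma IR_Gamma_inverse:
  assumes "(\<theta>, \<psi>, \<omega>) \<in> IR_Phi D"
  shows "((\<chi> i. 1 / \<psi> $ i), \<theta>, \<psi>, \<omega>) \<in> IR_Gamma D"
  using assms IR_Phi_dest(5)[OF assms] by (simp add: IR_Gamma_def less_imp_neq[THEN not_sym])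

lemma IR_Gamma_nonempty: "IR_Gamma D \<noteq> {}"
  using IR_Phi_nonempty IR_Gamma_inverse by auto

lemma IR_Gamma_dest:
  assumes "(\<psi>o, \<theta>, \<psi>, \<omega>) \<in> IR_Gamma D"
  shows "(\<theta>, \<psi>, \<omega>) \<in> IR_Phi D" "\<psi>o $ i = 1 / \<psi> $ i"
proof -
  show "(\<theta>, \<psi>, \<omega>) \<in> IR_Phi D" using assms by (simp add: IR_Gamma_def)
  from IR_Phi_dest(5)[OF this, of i] show "\<psi>o $ i = 1 / \<psi> $ i"
    using assms by (simp add: IR_Gamma_def field_simps)
qed

lemma IR_Gamma_nonneg: "IR_Gamma D \<subseteq> nonneg_orthant"
proof
  fix \<gamma> assume g: "\<gamma> \<in> IR_Gamma D"
  obtain \<psi>o \<theta> \<psi> \<omega> where e: "\<gamma> = (\<psi>o, \<theta>, \<psi>, \<omega>)" by (cases \<gamma>) auto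
  note d = IR_Gamma_dest[OF g[unfolded e]]
  show "\<gamma> \<in> nonneg_orthant"
    unfolding e using IR_Phi_dest(4,5,7)[OF d(1)]
    by (intro nonneg_orthantI) (auto simp: d(2) less_imp_le)
qed

lemma objective_eq:
  assumes "(\<psi>o, \<theta>, \<psi>, \<omega>) \<in> IR_Gamma D"
  shows "C1 (\<psi>o, \<theta>, \<psi>, \<omega>) - C2 (\<psi>o, \<theta>, \<psi>, \<omega>) = (\<Sum>i\<in>UNIV. \<theta> $ i * \<omega> $ i / \<psi> $ i)"
  unfolding C1_minus_C2 IR_Gamma_dest(2)[OF assms] by simp

lemma f_low_le:
  assumes g: "\<gamma> \<in> IR_Gamma D"
  shows "f_low D \<le> fyx D + C1 \<gamma> - C2 \<gamma>"
proof -
  obtain \<psi>o \<theta> \<psi> \<omega> where e: "\<gamma> = (\<psi>o, \<theta>, \<psi>, \<omega>)" by (cases \<gamma>) auto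
  have "bdd_below ((\<lambda>(\<theta>, \<psi>, \<omega>). fyx D + (\<Sum>i\<in>UNIV. \<theta> $ i * \<omega> $ i / \<psi> $ i)) ` IR_Phi D)"
    using IR_Phi_dest(4,5,7)
    by (intro bdd_belowI[of _ "fyx D"])
      (auto intro!: sum_nonneg divide_nonneg_pos mult_nonneg_nonneg)
  from cINF_lower[OF this IR_Gamma_dest(1)[OF g[unfolded e]]] show ?thesis
    using objective_eq[OF g[unfolded e]] unfolding f_low_def e by simp
qed

text \<open>
  The bound \<open>v\<close> is an extended real because it will be the value of a linear program; that it is
  not \<open>\<infinity>\<close> is part of the conclusion, and holds because the feasible region is nonempty.
\<close>

lemma le_f_low:
  assumes "\<And>\<gamma>. \<gamma> \<in> IR_Gamma D \<Longrightarrow> v \<le> ereal (fyx D + C1 \<gamma> - C2 \<gamma>)"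
  shows "v \<le> ereal (f_low D)"
proof (cases v)
  case (real r)
  have "r \<le> fyx D + (\<Sum>i\<in>UNIV. \<theta> $ i * \<omega> $ i / \<psi> $ i)" if p: "(\<theta>, \<psi>, \<omega>) \<in> IR_Phi D" for \<theta> \<psi> \<omega>
    using assms[OF IR_Gamma_inverse[OF p]] objective_eq[OF IR_Gamma_inverse[OF p]]
    by (simp add: real)
  then show ?thesis
    unfolding f_low_def real by (auto intro!: cINF_greatest IR_Phi_nonempty)
next
  case PInf
  then show ?thesis using assms IR_Gamma_nonempty by fastforce
qed auto

lemma gam_low_le:
  assumes "b \<in> Basis" "\<gamma> \<in> IR_Gamma D"
  shows "gam_low D b \<le> \<gamma> \<bullet> b"
  unfolding gam_low_def
  using assms IR_Gamma_nonneg
  by (intro cINF_lower bdd_belowI[of _ 0]) (auto simp: nonneg_orthant_def)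

lemma gam_low_nonneg: "b \<in> Basis \<Longrightarrow> 0 \<le> gam_low D b"
  unfolding gam_low_def
  using IR_Gamma_nonneg IR_Gamma_nonempty
  by (intro cINF_greatest) (auto simp: nonneg_orthant_def)

lemma S0_nonneg: "S0 D \<subseteq> nonneg_orthant"
  using order_trans[OF gam_low_nonneg] by (auto simp: S0_def nonneg_orthant_def)

lemma convex_S0: "convex (S0 D)"
proof -
  have "S0 D = {\<gamma>. (\<Sum>b\<in>Basis. b) \<bullet> \<gamma> \<le> alpha D} \<inter> (\<Inter>b\<in>Basis. {\<gamma>. b \<bullet> \<gamma> \<ge> gam_low D b})"
  proof (rule set_eqI)
    fix \<gamma>
    show "\<gamma> \<in> S0 D \<longleftrightarrow> \<gamma> \<in> {\<gamma>. (\<Sum>b\<in>Basis. b) \<bullet> \<gamma> \<le> alpha D} \<inter> (\<Inter>b\<in>Basis. {\<gamma>. b \<bullet> \<gamma> \<ge> gam_low D b})"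
      by (simp add: S0_def inner_sum_left inner_commute[of \<gamma>])
  qed
  then show ?thesis
    by (auto intro!: convex_Int convex_INT convex_halfspace_le convex_halfspace_ge)
qed

lemma psi_bounds:
  assumes "(\<theta>, \<psi>, \<omega>) \<in> IR_Phi D"
  shows "0 < psi_low D" "psi_low D \<le> \<psi> $ i" "\<psi> $ i \<le> psi_upp D"
proof -
  have psi: "(a, b, c, e) \<bullet> psi_coord i = c $ i" for a b c e and i :: 'd
    by (simp add: inner_axis)
  have "\<delta> \<le> gam_low D (psi_coord i)" for i
    unfolding gam_low_def
  proof (rule cINF_greatest[OF IR_Gamma_nonempty])
    fix \<gamma> assume g: "\<gamma> \<in> IR_Gamma D"
    obtain \<psi>o \<theta> \<psi> \<omega> where e: "\<gamma> = (\<psi>o, \<theta>, \<psi>, \<omega>)" by (cases \<gamma>) auto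
    show "\<delta> \<le> \<gamma> \<bullet> psi_coord i"
      unfolding e psi by (rule delta_le[OF IR_Gamma_dest(1)[OF g[unfolded e]]])
  qed
  from less_le_trans[OF delta_pos this] show "0 < psi_low D" by (auto simp: psi_low_def)
  have "psi_low D \<le> gam_low D (psi_coord i)" by (simp add: psi_low_def)
  also have "\<dots> \<le> \<psi> $ i"
    using gam_low_le[OF coordinate_Basis(3) IR_Gamma_inverse[OF assms], of i] by (simp add: inner_axis)
  finally show "psi_low D \<le> \<psi> $ i" .
  have "\<psi> $ i \<le> gam_upp D (psi_coord i)"
  proof -
    have "bdd_above ((\<lambda>\<gamma>. \<gamma> \<bullet> psi_coord i) ` IR_Gamma D)"
      by (intro bdd_aboveI[of _ "fx D"])
        (auto simp: inner_axis intro: IR_Phi_dest(6)[OF IR_Gamma_dest(1)])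
    from cSUP_upper[OF IR_Gamma_inverse[OF assms] this] show ?thesis
      by (simp add: gam_upp_def inner_axis)
  qed
  also have "\<dots> \<le> psi_upp D" by (simp add: psi_upp_def)
  finally show "\<psi> $ i \<le> psi_upp D" .
qed

text \<open>
  This is Kantorovich's inequality for \<open>\<psi>\<close>.  On \<open>[l, u]\<close> the convex function \<open>t \<mapsto> 1/t\<close> lies
  below its chord, which bounds the sum by a function of \<open>\<Sum>\<psi>\<^sub>i = f(X=x)\<close> alone; the inequality
  of arithmetic and geometric means, \<open>4 F (z - F) \<le> z\<^sup>2\<close> with \<open>z = n (l + u)\<close>, does the rest.
\<close>

lemma sum_inverse_le:
  assumes "(\<theta>, \<psi>, \<omega>) \<in> IR_Phi D"
  shows "(\<Sum>i\<in>UNIV. 1 / \<psi> $ i)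
    \<le> (real CARD('d))\<^sup>2 * (psi_low D + psi_upp D)\<^sup>2 / (4 * fx D * psi_low D * psi_upp D)"
proof -
  define l u n F where "l = psi_low D" and "u = psi_upp D" and "n = real CARD('d)" and "F = fx D"
  have b: "0 < l" "l \<le> \<psi> $ i" "\<psi> $ i \<le> u" for i
    using psi_bounds[OF assms] by (auto simp: l_def u_def)
  have u: "0 < u" using b(1) b(2,3)[of undefined] by linarith
  have F: "0 < F" using IR_Phi_dest(5,6)[OF assms, of undefined] by (simp add: F_def)
  have "1 / \<psi> $ i \<le> (l + u - \<psi> $ i) / (l * u)" for i
  proof -
    have "0 \<le> (\<psi> $ i - l) * (u - \<psi> $ i)" using b(1) b(2,3)[of i] by simp
    then have "l * u \<le> (l + u - \<psi> $ i) * \<psi> $ i" by (simp add: algebra_simps)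
    then show ?thesis using b(1) b(2,3)[of i] u by (simp add: field_simps)
  qed
  then have "(\<Sum>i\<in>UNIV. 1 / \<psi> $ i) \<le> (\<Sum>i\<in>UNIV. (l + u - \<psi> $ i) / (l * u))"
    by (intro sum_mono)
  also have "\<dots> = (n * (l + u) - F) / (l * u)"
    using IR_Phi_dest(2)[OF assms]
    by (simp add: sum_divide_distrib[symmetric] sum_subtractf n_def F_def)
  also have "\<dots> = 4 * F * (n * (l + u) - F) / (4 * F * l * u)"
    using F b(1) b(2,3)[of undefined] u by (simp add: field_simps)
  also have "\<dots> \<le> n\<^sup>2 * (l + u)\<^sup>2 / (4 * F * l * u)"
  proof (rule divide_right_mono)
    have "0 \<le> (n * (l + u) - 2 * F)\<^sup>2" by simp
    then show "4 * F * (n * (l + u) - F) \<le> n\<^sup>2 * (l + u)\<^sup>2"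
      by (simp add: power2_eq_square algebra_simps)
    show "0 \<le> 4 * F * l * u" using F b(1) b(2,3)[of undefined] u by simp
  qed
  finally show ?thesis by (simp add: l_def u_def n_def F_def)
qed

text \<open>
  The number \<open>alpha\<close> bounds the coordinate sum \<open>\<Sum>1/\<psi>\<^sub>i + f(y,X=x) + f(X=x) + f(X\<noteq>x)\<close>.
\<close>

lemma IR_Gamma_subset_S0: "IR_Gamma D \<subseteq> S0 D"
proof
  fix \<gamma> assume g: "\<gamma> \<in> IR_Gamma D"
  obtain \<psi>o \<theta> \<psi> \<omega> where e: "\<gamma> = (\<psi>o, \<theta>, \<psi>, \<omega>)" by (cases \<gamma>) auto
  note d = IR_Gamma_dest[OF g[unfolded e]]
  have "(\<Sum>b\<in>Basis. \<gamma> \<bullet> b) = (\<Sum>i\<in>UNIV. 1 / \<psi> $ i) + fyx D + fx D + fnx D"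
    using IR_Phi_dest(1-3)[OF d(1)]
    by (simp add: e sum_inner_Basis_prod sum_inner_Basis_real_vec d(2))
  also have "\<dots> \<le> alpha D"
    using sum_inverse_le[OF d(1)] fx_fnx by (simp add: alpha_def)
  finally show "\<gamma> \<in> S0 D"
    using gam_low_le[OF _ g] by (simp add: S0_def)
qed

text \<open>
  If the halfspace \<open>\<Sum>\<gamma>\<^sub>i \<le> alpha\<close> leaves room above the corner \<open>l\<close> of lower bounds, the set has
  interior points, thus full dimension \<open>4 d\<close>, and \<open>4 d + 1\<close> points with such a hull are affinely
  independent.  Otherwise only the corner is left.
\<close>

lemma S0_simplex_or_point:
  assumes len: "length V = 4 * CARD('d) + 1" and hull: "hull_of V = S0 D"
  shows "simplex_or_point V"
proof -
  define l :: "'d gam" where "l = (\<Sum>b\<in>Basis. gam_low D b *\<^sub>R b)"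
  have l: "l \<bullet> b = gam_low D b" if "b \<in> Basis" for b
    using that by (simp add: l_def inner_sum_left_Basis)
  define s where "s = (\<Sum>b\<in>(Basis::'d gam set). gam_low D b)"
  show ?thesis
  proof (cases "s < alpha D")
    case True
    define G where "G = {\<gamma>::'d gam. (\<Sum>b\<in>Basis. b) \<bullet> \<gamma> < alpha D}
        \<inter> (\<Inter>b\<in>Basis. {\<gamma>. b \<bullet> \<gamma> > gam_low D b})"
    have "open G"
      unfolding G_def by (intro open_Int open_INT ballI open_halfspace_lt open_halfspace_gt) auto
    moreover have "G \<subseteq> S0 D"
    proof
      fix \<gamma> assume "\<gamma> \<in> G"
      then show "\<gamma> \<in> S0 D"
        by (simp add: G_def S0_def inner_sum_left inner_commute[of \<gamma>] less_imp_le)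
    qed
    moreover have "G \<noteq> {}"
    proof -
      define n where "n = real DIM('d gam)"
      have n: "0 < n" by (simp add: n_def)
      define e where "e = (alpha D - s) / (2 * n)"
      have e: "0 < e" using True n by (simp add: e_def)
      define p where "p = l + (\<Sum>b\<in>Basis. e *\<^sub>R b)"
      have p: "p \<bullet> b = gam_low D b + e" if "b \<in> Basis" for b
        using that by (simp add: p_def inner_add_left l inner_sum_left_Basis)
      have "(\<Sum>b\<in>Basis. b) \<bullet> p = s + n * e"
      proof -
        have "(\<Sum>b\<in>Basis. b) \<bullet> p = (\<Sum>b\<in>Basis. p \<bullet> b)"
          by (simp only: inner_sum_left inner_commute[of p])
        also have "\<dots> = (\<Sum>b\<in>Basis. gam_low D b + e)" by (intro sum.cong p refl)
        finally show ?thesis by (simp add: sum.distrib s_def n_def)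
      qed
      also have "\<dots> < alpha D" using True n by (simp add: e_def field_simps)
      finally have "p \<in> G" using p e by (simp add: G_def inner_commute)
      then show ?thesis by auto
    qed
    ultimately have "interior (S0 D) \<noteq> {}" using interior_maximal by blast
    then have "aff_dim (set V) = int (DIM('d gam))"
      using aff_dim_nonempty_interior[of "S0 D"] hull by (metis aff_dim_convex_hull)
    then have dim: "aff_dim (set V) = int (4 * CARD('d))" by simp
    have "aff_dim (set V) \<le> int (card (set V)) - 1"
      by (rule aff_dim_le_card) simp
    then have card: "card (set V) = length V"
      using dim len card_length[of V] by simp
    then have dist: "distinct V" by (rule card_distinct)
    have ind: "\<not> affine_dependent (set V)"
      using dim card len by (simp add: affine_independent_iff_card)
    have bij: "bij_betw ((!) V) {..<length V} (set V)"
      by (rule bij_betw_nth[OF dist]) auto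
    have "\<forall>j<length V. k j = 0"
      if k: "(\<Sum>j<length V. k j) = 0" "(\<Sum>j<length V. k j *\<^sub>R V ! j) = 0" for k :: "nat \<Rightarrow> real"
    proof -
      define U where "U v = k (the_inv_into {..<length V} ((!) V) v)" for v
      have U: "U (V ! j) = k j" if "j < length V" for j
        unfolding U_def using that bij
        by (subst the_inv_into_f_f) (auto simp: bij_betw_def)
      have "sum U (set V) = 0" "(\<Sum>v\<in>set V. U v *\<^sub>R v) = 0"
        using k U by (simp_all add: sum.reindex_bij_betw[OF bij, symmetric])
      with ind have "\<forall>v\<in>set V. U v = 0"
        by (auto simp: affine_dependent_explicit_finite)
      with U show ?thesis by (metis nth_mem)
    qed
    then show ?thesis by (auto simp: simplex_or_point_def)
  next
    case False
    have "\<gamma> = l" if "\<gamma> \<in> S0 D" for \<gamma>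
    proof (rule euclidean_eqI)
      fix b :: "'d gam" assume b: "b \<in> Basis"
      have ge: "gam_low D c \<le> \<gamma> \<bullet> c" if "c \<in> Basis" for c using that \<open>\<gamma> \<in> S0 D\<close> by (simp add: S0_def)
      have "(\<Sum>c\<in>Basis. \<gamma> \<bullet> c) \<le> (\<Sum>c\<in>Basis. gam_low D c)"
        using False \<open>\<gamma> \<in> S0 D\<close> by (simp add: S0_def s_def)
      then have "(\<Sum>c\<in>Basis. \<gamma> \<bullet> c - gam_low D c) \<le> 0" by (simp add: sum_subtractf)
      moreover have "\<gamma> \<bullet> b - gam_low D b \<le> (\<Sum>c\<in>Basis. \<gamma> \<bullet> c - gam_low D c)"
        using ge b by (intro member_le_sum) auto
      ultimately show "\<gamma> \<bullet> b = l \<bullet> b" using ge[OF b] l[OF b] by linarith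
    qed
    moreover have "V ! j \<in> S0 D" if "j < length V" for j
      using that hull by (metis hull_inc nth_mem)
    ultimately have "V ! j = l" if "j < length V" for j using that by blast
    then show ?thesis by (simp add: simplex_or_point_def)
  qed
qed

end

section \<open>The linear programs\<close>

lemma norm_le_sqrt_card:
  fixes x :: "real^'n::finite"
  assumes "\<And>i. \<bar>x $ i\<bar> \<le> c"
  shows "norm x \<le> sqrt (real CARD('n)) * c"
proof -
  have "0 \<le> c" using order_trans[OF abs_ge_zero assms] .
  have "(\<Sum>i\<in>UNIV. (x $ i)\<^sup>2) \<le> (\<Sum>i\<in>(UNIV::'n set). c\<^sup>2)"
    using assms \<open>0 \<le> c\<close> by (intro sum_mono) (simp add: abs_le_square_iff[symmetric])
  then have "norm x \<le> sqrt (real CARD('n) * c\<^sup>2)"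
    by (simp add: norm_vec_def L2_set_def)
  also have "\<dots> = sqrt (real CARD('n)) * c"
    using \<open>0 \<le> c\<close> by (simp add: real_sqrt_mult)
  finally show ?thesis .
qed

locale pi_sfp = bounded_program D \<delta>
  for D :: "('w::finite, 'd::finite) known_data" and \<delta> :: real +
  fixes tp :: "'d tangency"
    and Coll :: "nat \<Rightarrow> 'd vsimplex multiset"
    and sel T T' :: "nat \<Rightarrow> 'd vsimplex"
  assumes tangency: "S \<noteq> [] \<Longrightarrow> tp S F \<in> hull_of S"
    and run: "pi_sfp_run D tp Coll sel T T'"
begin

lemma root:
  obtains V where "length V = 4 * CARD('d) + 1" "hull_of V = S0 D" "Coll 0 = {#V#}"
  using run unfolding pi_sfp_run_def by blast

lemma compact_S0: "compact (S0 D)"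
  by (metis root finite_imp_compact_convex_hull List.finite_set)

lemma S0_nonempty: "S0 D \<noteq> {}"
  using IR_Gamma_nonempty IR_Gamma_subset_S0 by blast

text \<open>
  The factor \<open>grad_scale\<close> is kept inside the supremum so that \<open>rate\<close> is literally the real
  version of \<open>rate_const\<close>.
\<close>

definition grad_scale :: real where
  "grad_scale = 2 * (sqrt 2 + 1) * sqrt (real CARD('d)) / \<delta>"

definition grad_sup :: real where
  "grad_sup = (SUP \<gamma>\<in>S0 D. grad_scale * norm (gradient (\<lambda>\<gamma>. C1 \<gamma> - C2 \<gamma>) \<gamma>))"

definition hess1_sup :: real where
  "hess1_sup = (SUP \<gamma>\<in>S0 D. hessian_frobenius C1 \<gamma>)"

definition hess2_sup :: real where
  "hess2_sup = (SUP \<gamma>\<in>S0 D. hessian_frobenius C2 \<gamma>)"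

definition rate :: real where
  "rate = grad_sup + hess1_sup + hess2_sup / 2"

lemma grad_scale_pos: "0 < grad_scale"
  using delta_pos by (simp add: grad_scale_def add_pos_pos)

text \<open>
  The suprema in the rate constant are finite because the gradient and the Hessians are continuous and
  the initial simplex is compact.
\<close>

lemma SUP_S0:
  fixes g :: "'d gam \<Rightarrow> real"
  assumes "continuous_on (S0 D) g"
  shows "\<gamma> \<in> S0 D \<Longrightarrow> g \<gamma> \<le> (SUP \<gamma>\<in>S0 D. g \<gamma>)"
    and "(SUP \<gamma>\<in>S0 D. ereal (g \<gamma>)) = ereal (SUP \<gamma>\<in>S0 D. g \<gamma>)"
proof -
  have "bdd_above (g ` S0 D)"
    by (intro bounded_imp_bdd_above compact_imp_bounded
        compact_continuous_image[OF assms compact_S0])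
  then show le: "\<gamma> \<in> S0 D \<Longrightarrow> g \<gamma> \<le> (SUP \<gamma>\<in>S0 D. g \<gamma>)" for \<gamma>
    by (rule cSUP_upper[rotated])
  obtain \<gamma>0 where g0: "\<gamma>0 \<in> S0 D" using S0_nonempty by blast
  have "(SUP \<gamma>\<in>S0 D. ereal (g \<gamma>)) \<le> ereal (SUP \<gamma>\<in>S0 D. g \<gamma>)"
    using le by (intro SUP_least) simp
  moreover have "ereal (g \<gamma>0) \<le> (SUP \<gamma>\<in>S0 D. ereal (g \<gamma>))"
    using g0 by (rule SUP_upper)
  ultimately have "\<bar>SUP \<gamma>\<in>S0 D. ereal (g \<gamma>)\<bar> \<noteq> \<infinity>" by auto
  then show "(SUP \<gamma>\<in>S0 D. ereal (g \<gamma>)) = ereal (SUP \<gamma>\<in>S0 D. g \<gamma>)"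
    by (simp add: ereal_SUP)
qed

lemma real_polynomial_function_objective: "real_polynomial_function (\<lambda>\<gamma>. C1 \<gamma> - C2 \<gamma>)"
  by (intro real_polynomial_function_diff real_polynomial_function_C1 real_polynomial_function_C2)

lemma continuous_on_grad:
  "continuous_on (S0 D) (\<lambda>\<gamma>. grad_scale * norm (gradient (\<lambda>\<gamma>. C1 \<gamma> - C2 \<gamma>) \<gamma>))"
  by (intro continuous_intros continuous_on_polymonial_function polynomial_function_gradient
      real_polynomial_function_objective)

lemmas continuous_on_hess =
  continuous_on_hessian_frobenius[OF real_polynomial_function_C1]
  continuous_on_hessian_frobenius[OF real_polynomial_function_C2]

lemma rate_const_eq: "rate_const D \<delta> = ereal rate"
  unfolding rate_const_def rate_def grad_sup_def hess1_sup_def hess2_sup_def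
    grad_scale_def[symmetric] SUP_S0(2)[OF continuous_on_grad]
    SUP_S0(2)[OF continuous_on_hess(1)] SUP_S0(2)[OF continuous_on_hess(2)]
  by simp

lemma smooth_convex_C1: "smooth_convex_on (S0 D) hess1_sup C1"
  unfolding hess1_sup_def
  by (intro smooth_convex_on_polynomial real_polynomial_function_C1 SUP_S0(1) continuous_on_hess
      convex_on_subset[OF convex_on_C1] S0_nonneg convex_S0)

lemma smooth_convex_C2: "smooth_convex_on (S0 D) hess2_sup C2"
  unfolding hess2_sup_def
  by (intro smooth_convex_on_polynomial real_polynomial_function_C2 SUP_S0(1) continuous_on_hess
      convex_on_subset[OF convex_on_C2] S0_nonneg convex_S0)

lemma sups_nonneg: "0 \<le> grad_sup" "0 \<le> hess1_sup" "0 \<le> hess2_sup"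
proof -
  obtain \<gamma> where g: "\<gamma> \<in> S0 D" using S0_nonempty by blast
  have "0 \<le> hessian_frobenius F \<gamma>" for F
    by (simp add: hessian_frobenius_def sum_nonneg)
  then show "0 \<le> hess1_sup" "0 \<le> hess2_sup"
    using SUP_S0(1)[OF continuous_on_hess(1) g] SUP_S0(1)[OF continuous_on_hess(2) g]
    unfolding hess1_sup_def hess2_sup_def by (meson order_trans)+
  have "0 \<le> grad_scale * norm (gradient (\<lambda>\<gamma>. C1 \<gamma> - C2 \<gamma>) \<gamma>)" using grad_scale_pos by simp
  then show "0 \<le> grad_sup"
    using SUP_S0(1)[OF continuous_on_grad g] unfolding grad_sup_def by linarith
qed

text \<open>
  The invariant of all simplices that occur in a run.  It makes every tangent and secant
  approximation an estimate from the correct side, with an error controlled by the edges.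
\<close>

definition admissible :: "'d vsimplex \<Rightarrow> bool" where
  "admissible S \<longleftrightarrow> length S = 4 * CARD('d) + 1 \<and> simplex_or_point S \<and> hull_of S \<subseteq> S0 D"

lemma
  assumes S: "admissible S" and g: "\<gamma> \<in> hull_of S"
  shows tan_C1_le: "tan_approx tp S C1 \<gamma> \<le> C1 \<gamma>"
    and tan_C1_ge: "edges_sq_le S h \<Longrightarrow> C1 \<gamma> - tan_approx tp S C1 \<gamma> \<le> hess1_sup / 2 * h"
    and sec_C2_ge: "C2 \<gamma> \<le> sec_approx S C2 \<gamma>"
    and sec_C2_le: "edges_sq_le S h \<Longrightarrow> sec_approx S C2 \<gamma> - C2 \<gamma> \<le> hess2_sup / 2 * h"
    and tan_D1_le: "tan_approx tp S (D1 i) \<gamma> \<le> D1 i \<gamma>"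
    and tan_D1_ge: "edges_sq_le S h \<Longrightarrow> D1 i \<gamma> - tan_approx tp S (D1 i) \<gamma> \<le> h"
    and tan_D2_le: "tan_approx tp S (D2 i) \<gamma> \<le> D2 i \<gamma>"
    and tan_D2_ge: "edges_sq_le S h \<Longrightarrow> D2 i \<gamma> - tan_approx tp S (D2 i) \<gamma> \<le> h / 2"
    and sec_D1_ge: "D1 i \<gamma> \<le> sec_approx S (D1 i) \<gamma>"
    and sec_D1_le: "edges_sq_le S h \<Longrightarrow> sec_approx S (D1 i) \<gamma> - D1 i \<gamma> \<le> h"
    and sec_D2_ge: "D2 i \<gamma> \<le> sec_approx S (D2 i) \<gamma>"
    and sec_D2_le: "edges_sq_le S h \<Longrightarrow> sec_approx S (D2 i) \<gamma> - D2 i \<gamma> \<le> h / 2"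
proof -
  have ne: "S \<noteq> []" and sp: "simplex_or_point S" and sub: "hull_of S \<subseteq> S0 D"
    using S by (auto simp: admissible_def)
  have "bounded (set S)" by (simp add: finite_imp_bounded)
  then have dia: "edges_sq_le S ((diameter (set S))\<^sup>2)"
    by (auto simp: edges_sq_le_def intro!: power_mono diameter_bounded_bound)
  note C1 = smooth_convex_on_subset[OF smooth_convex_C1 sub]
  note C2 = smooth_convex_on_subset[OF smooth_convex_C2 sub]
  note tan = tan_approx_error[where tp = tp and S = S and \<gamma> = \<gamma>, OF _ _ _ tangency[OF ne] g]
  note sec = sec_approx_error[where S = S and \<gamma> = \<gamma>, OF _ _ _ sp g]
  show "tan_approx tp S C1 \<gamma> \<le> C1 \<gamma>" by (rule tan(1)[OF C1 dia sups_nonneg(2)])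
  show "C2 \<gamma> \<le> sec_approx S C2 \<gamma>" by (rule sec(1)[OF C2 dia sups_nonneg(3)])
  show "tan_approx tp S (D1 i) \<gamma> \<le> D1 i \<gamma>" by (rule tan(1)[OF smooth_convex_on_D1 dia]) simp
  show "tan_approx tp S (D2 i) \<gamma> \<le> D2 i \<gamma>" by (rule tan(1)[OF smooth_convex_on_D2 dia]) simp
  show "D1 i \<gamma> \<le> sec_approx S (D1 i) \<gamma>" by (rule sec(1)[OF smooth_convex_on_D1 dia]) simp
  show "D2 i \<gamma> \<le> sec_approx S (D2 i) \<gamma>" by (rule sec(1)[OF smooth_convex_on_D2 dia]) simp
  assume h: "edges_sq_le S h"
  show "C1 \<gamma> - tan_approx tp S C1 \<gamma> \<le> hess1_sup / 2 * h" by (rule tan(2)[OF C1 h sups_nonneg(2)])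
  show "sec_approx S C2 \<gamma> - C2 \<gamma> \<le> hess2_sup / 2 * h" by (rule sec(2)[OF C2 h sups_nonneg(3)])
  show "D1 i \<gamma> - tan_approx tp S (D1 i) \<gamma> \<le> h" using tan(2)[OF smooth_convex_on_D1 h] by simp
  show "D2 i \<gamma> - tan_approx tp S (D2 i) \<gamma> \<le> h / 2" using tan(2)[OF smooth_convex_on_D2 h] by simp
  show "sec_approx S (D1 i) \<gamma> - D1 i \<gamma> \<le> h" using sec(2)[OF smooth_convex_on_D1 h] by simp
  show "sec_approx S (D2 i) \<gamma> - D2 i \<gamma> \<le> h / 2" using sec(2)[OF smooth_convex_on_D2 h] by simp
qed

text \<open>
  Tangents underestimate and secants overestimate, so each linear program is a relaxation of the
  original program on its simplex: points of \<open>IR_Gamma\<close> stay feasible and their objective does not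
  increase.
\<close>

lemma lp_bound_le:
  assumes S: "admissible S" and g: "\<gamma> \<in> IR_Gamma D" "\<gamma> \<in> hull_of S"
  shows "lp_bound D tp S \<le> ereal (fyx D + C1 \<gamma> - C2 \<gamma>)"
proof -
  obtain \<psi>o \<theta> \<psi> \<omega> where e: "\<gamma> = (\<psi>o, \<theta>, \<psi>, \<omega>)" by (cases \<gamma>) auto
  have one: "D1 i \<gamma> - D2 i \<gamma> = 1" for i
    using g(1) by (simp add: e D1_minus_D2 IR_Gamma_def)
  have "tan_approx tp S (D1 i) \<gamma> - sec_approx S (D2 i) \<gamma> \<le> 1"
      "sec_approx S (D1 i) \<gamma> - tan_approx tp S (D2 i) \<gamma> \<ge> 1" for i
    using one[of i] tan_D1_le[OF S g(2), of i] sec_D2_ge[OF S g(2), of i]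
      sec_D1_ge[OF S g(2), of i] tan_D2_le[OF S g(2), of i] by linarith+
  then have "\<gamma> \<in> lp_feasible D tp S"
    using g IR_Gamma_dest(1)[OF g(1)[unfolded e]] by (simp add: lp_feasible_def e)
  then have "lp_bound D tp S \<le> ereal (fyx D + tan_approx tp S C1 \<gamma> - sec_approx S C2 \<gamma>)"
    using g by (auto simp: lp_bound_def intro: INF_lower)
  also have "\<dots> \<le> ereal (fyx D + C1 \<gamma> - C2 \<gamma>)"
    using tan_C1_le[OF S g(2)] sec_C2_ge[OF S g(2)] by simp
  finally show ?thesis .
qed

text \<open>
  Conversely, a point \<open>\<gamma>\<close> feasible for the linear program satisfies \<open>\<psi>\<^sup>o \<psi> = 1\<close> up to
  \<open>3/2 h\<close>.  Replacing its part \<open>\<psi>\<^sup>o\<close> by \<open>1/\<psi>\<close> yields a point of \<open>IR_Gamma\<close>, whose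
  objective is at least \<open>f_low\<close>, at distance at most \<open>sqrt d (3/2) h / \<delta>\<close>: here the lower bound
  on \<open>\<psi>\<close> enters.  The three terms of \<open>rate\<close> account for this move, for the tangent of \<open>C1\<close>
  and for the secant of \<open>C2\<close>.  The new point may leave the simplex, but both points are in the
  convex set \<open>S0\<close>, where the gradient bound holds.
\<close>

lemma lp_bound_ge:
  assumes S: "admissible S" and h: "edges_sq_le S h"
  shows "ereal (f_low D - rate * h) \<le> lp_bound D tp S"
proof -
  have "f_low D - rate * h \<le> fyx D + tan_approx tp S C1 \<gamma> - sec_approx S C2 \<gamma>"
    if feas: "\<gamma> \<in> lp_feasible D tp S" for \<gamma>
  proof -
    obtain \<psi>o \<theta> \<psi> \<omega> where e: "\<gamma> = (\<psi>o, \<theta>, \<psi>, \<omega>)" by (cases \<gamma>) auto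
    have g: "\<gamma> \<in> hull_of S" and phi: "(\<theta>, \<psi>, \<omega>) \<in> IR_Phi D"
      and le: "\<And>i. tan_approx tp S (D1 i) \<gamma> - sec_approx S (D2 i) \<gamma> \<le> 1"
      and ge: "\<And>i. sec_approx S (D1 i) \<gamma> - tan_approx tp S (D2 i) \<gamma> \<ge> 1"
      using feas by (auto simp: lp_feasible_def e)
    define \<gamma>' :: "'d gam" where "\<gamma>' = ((\<chi> i. 1 / \<psi> $ i), \<theta>, \<psi>, \<omega>)"
    have g': "\<gamma>' \<in> IR_Gamma D" unfolding \<gamma>'_def by (rule IR_Gamma_inverse[OF phi])
    have h0: "0 \<le> h" using hull_dist_sq_le[OF h g g] by simp
    have "\<bar>(\<psi>o - (\<chi> i. 1 / \<psi> $ i)) $ i\<bar> \<le> 3/2 * h / \<delta>" for i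
    proof -
      have "\<bar>\<psi>o $ i * \<psi> $ i - 1\<bar> \<le> 3/2 * h"
        using D1_minus_D2[of i \<psi>o \<theta> \<psi> \<omega>] le[of i] ge[of i]
          tan_D1_ge[OF S g h, of i] sec_D2_le[OF S g h, of i]
          sec_D1_le[OF S g h, of i] tan_D2_ge[OF S g h, of i]
        unfolding e by linarith
      moreover have "\<delta> \<le> \<psi> $ i" by (rule delta_le[OF phi])
      moreover have "(\<psi>o - (\<chi> i. 1 / \<psi> $ i)) $ i = (\<psi>o $ i * \<psi> $ i - 1) / \<psi> $ i"
        using \<open>\<delta> \<le> \<psi> $ i\<close> delta_pos by (simp add: field_simps)
      ultimately show ?thesis
        using delta_pos h0 frac_le[of "3/2 * h" "\<bar>\<psi>o $ i * \<psi> $ i - 1\<bar>" \<delta> "\<psi> $ i"]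
        by (simp only: abs_divide) simp
    qed
    from norm_le_sqrt_card[OF this]
    have dist: "dist \<gamma> \<gamma>' \<le> sqrt (real CARD('d)) * (3/2 * h / \<delta>)"
      by (simp add: e \<gamma>'_def dist_norm norm_Pair)
    have "sqrt (real CARD('d)) * (3/2 * h / \<delta>) = 3/2 * sqrt (real CARD('d)) / \<delta> * h" by simp
    also have "\<dots> \<le> grad_scale * h"
    proof (rule mult_right_mono[OF _ h0])
      have "3/2 \<le> 2 * (sqrt 2 + 1)" using real_sqrt_ge_zero[of 2] by simp
      then show "3/2 * sqrt (real CARD('d)) / \<delta> \<le> grad_scale"
        unfolding grad_scale_def using delta_pos by (intro divide_right_mono mult_right_mono) auto
    qed
    finally have dist: "dist \<gamma> \<gamma>' \<le> grad_scale * h" using dist by linarith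
    have grad: "norm (gradient (\<lambda>\<gamma>. C1 \<gamma> - C2 \<gamma>) z) \<le> grad_sup / grad_scale" if "z \<in> S0 D" for z
      using SUP_S0(1)[OF continuous_on_grad that] grad_scale_pos
      by (simp add: grad_sup_def field_simps)
    have "\<gamma> \<in> S0 D" using S g by (auto simp: admissible_def)
    moreover have "\<gamma>' \<in> S0 D" using g' IR_Gamma_subset_S0 by blast
    ultimately have "\<bar>(C1 \<gamma>' - C2 \<gamma>') - (C1 \<gamma> - C2 \<gamma>)\<bar> \<le> grad_sup / grad_scale * dist \<gamma> \<gamma>'"
      by (intro polynomial_lipschitz[OF real_polynomial_function_objective convex_S0] grad)
    also have "\<dots> \<le> grad_sup / grad_scale * (grad_scale * h)"
      using dist sups_nonneg(1) grad_scale_pos by (intro mult_left_mono) auto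
    also have "\<dots> = grad_sup * h" using grad_scale_pos by simp
    finally have lip: "(C1 \<gamma>' - C2 \<gamma>') - (C1 \<gamma> - C2 \<gamma>) \<le> grad_sup * h" by linarith
    have "hess1_sup / 2 * h \<le> hess1_sup * h" using sups_nonneg(2) h0 by simp
    moreover have "rate * h = grad_sup * h + hess1_sup * h + hess2_sup / 2 * h"
      by (simp add: rate_def algebra_simps)
    ultimately show ?thesis
      using lip f_low_le[OF g'] tan_C1_ge[OF S g h] sec_C2_le[OF S g h] by linarith
  qed
  then show ?thesis by (auto simp: lp_bound_def intro: INF_greatest)
qed

section \<open>The run of the algorithm\<close>

lemma run_step:
  "sel k \<in># Coll k" "S \<in># Coll k \<Longrightarrow> lp_bound D tp (sel k) \<le> lp_bound D tp S"
  "longest_edge_bisection (sel k) (T k) (T' k)"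
  "Coll (Suc k) = Coll k - {#sel k#} + {#T k, T' k#}"
  using run unfolding pi_sfp_run_def by blast+

lemma admissible_child:
  assumes "admissible S" "bisection_child S R"
  shows "admissible R"
  using assms bisection_child_length bisection_child_simplex_or_point bisection_child_hull
  unfolding admissible_def by fastforce

lemma admissible_Coll: "S \<in># Coll k \<Longrightarrow> admissible S"
proof (induction k arbitrary: S)
  case 0
  obtain V where "length V = 4 * CARD('d) + 1" "hull_of V = S0 D" "Coll 0 = {#V#}" by (rule root)
  then show ?case using 0 S0_simplex_or_point[of V] by (simp add: admissible_def)
next
  case (Suc k)
  then have "S \<in># Coll k \<or> S = T k \<or> S = T' k"
    by (auto simp: run_step(4) dest: in_diffD)
  then show ?case
    using Suc.IH run_step(1) admissible_child longest_edge_bisection_children[OF run_step(3)]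
    by blast
qed

lemma admissible_sel: "admissible (sel k)"
  using admissible_Coll run_step(1) .

lemma Coll_covers: "\<gamma> \<in> S0 D \<Longrightarrow> \<exists>S\<in>#Coll k. \<gamma> \<in> hull_of S"
proof (induction k)
  case 0
  obtain V where "hull_of V = S0 D" "Coll 0 = {#V#}" by (rule root)
  with 0 show ?case by simp
next
  case (Suc k)
  then obtain S where S: "S \<in># Coll k" "\<gamma> \<in> hull_of S" by blast
  show ?case
  proof (cases "S = sel k")
    case True
    then show ?thesis
      using S longest_edge_bisection_covers[OF run_step(3)[of k]] by (auto simp: run_step(4))
  next
    case False
    then have "S \<in># Coll k - {#sel k#}" using S(1) by (simp add: in_diff_count)
    then show ?thesis using S(2) by (auto simp: run_step(4))
  qed
qed

text \<open>
  A feasible point lies in some simplex of the current collection, whose bound is at most the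
  objective at this point; the selected simplex has the smallest bound of all.
\<close>

lemma lp_bound_sel_le: "lp_bound D tp (sel k) \<le> ereal (f_low D)"
proof (rule le_f_low)
  fix \<gamma> assume g: "\<gamma> \<in> IR_Gamma D"
  then obtain S where S: "S \<in># Coll k" "\<gamma> \<in> hull_of S"
    using Coll_covers IR_Gamma_subset_S0 by blast
  have "lp_bound D tp (sel k) \<le> lp_bound D tp S" by (rule run_step(2)[OF S(1)])
  also have "\<dots> \<le> ereal (fyx D + C1 \<gamma> - C2 \<gamma>)"
    by (rule lp_bound_le[OF admissible_Coll[OF S(1)] g S(2)])
  finally show "lp_bound D tp (sel k) \<le> ereal (fyx D + C1 \<gamma> - C2 \<gamma>)" .
qed

lemma f_opt_le: "f_opt D tp sel n \<le> ereal (f_low D)"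
  using lp_bound_sel_le by (simp add: f_opt_def)

definition nested_chain :: "nat \<Rightarrow> nat \<Rightarrow> bool" where
  "nested_chain n l \<longleftrightarrow> (\<exists>i::nat \<Rightarrow> nat. strict_mono_on {0..l} i \<and> i l \<le> n \<and>
     (\<forall>j<l. sel (i (Suc j)) \<in> {T (i j), T' (i j)}))"

abbreviation depth :: "nat \<Rightarrow> nat" where
  "depth \<equiv> longest_nested sel T T'"

lemma nested_chain_le:
  assumes "nested_chain n l"
  shows "l \<le> n"
proof -
  obtain i where i: "strict_mono_on {0..l} i" "i l \<le> n"
    using assms by (auto simp: nested_chain_def)
  have "j \<le> i j" if "j \<le> l" for j
    using that
  proof (induction j)
    case (Suc j)
    then show ?case using strict_mono_onD[OF i(1), of j "Suc j"] by simp
  qed simp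
  with i(2) show ?thesis using le_trans by blast
qed

lemma longest_nested_eq: "depth n = (GREATEST l. nested_chain n l)"
  by (simp add: longest_nested_def nested_chain_def)

lemma nested_chain_0: "nested_chain n 0"
  by (auto simp: nested_chain_def strict_mono_on_def)

lemma nested_chain_depth: "nested_chain n (depth n)"
  unfolding longest_nested_eq
  by (rule GreatestI_nat[where P = "nested_chain n", OF nested_chain_0 nested_chain_le])

lemma nested_chain_le_depth: "nested_chain n l \<Longrightarrow> l \<le> depth n"
  unfolding longest_nested_eq
  by (rule Greatest_le_nat[where P = "nested_chain n", OF _ nested_chain_le])

text \<open>
  The last member of a longest nested sequence has short edges, so its bound is close to \<open>f_low\<close>,
  and the output is the maximum of such bounds.
\<close>

lemma f_opt_ge:
  "ereal (f_low D - rate * ((3/4) ^ (depth n div (4 * CARD('d))) * (diameter (S0 D))\<^sup>2))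
     \<le> f_opt D tp sel n"
proof -
  obtain i where i: "i (depth n) \<le> n" "\<forall>j<depth n. sel (i (Suc j)) \<in> {T (i j), T' (i j)}"
    using nested_chain_depth[of n] by (auto simp: nested_chain_def)
  have "edges_sq_le (sel (i 0)) ((diameter (S0 D))\<^sup>2)"
    unfolding edges_sq_le_def
  proof (intro allI impI power_mono)
    fix p q assume pq: "p < length (sel (i 0))" "q < length (sel (i 0))"
    have "sel (i 0) ! r \<in> S0 D" if "r < length (sel (i 0))" for r
      using admissible_sel[of "i 0"] hull_inc[OF nth_mem[OF that], of convex]
      by (auto simp: admissible_def)
    with pq show "dist (sel (i 0) ! p) (sel (i 0) ! q) \<le> diameter (S0 D)"
      by (intro diameter_bounded_bound compact_imp_bounded compact_S0)
  qed simp
  moreover have "length (sel (i 0)) = Suc (4 * CARD('d))"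
    using admissible_sel by (simp add: admissible_def)
  moreover have "bisection_child (sel (i t)) (sel (i (Suc t)))" if "t < depth n" for t
    using i(2) that longest_edge_bisection_children[OF run_step(3)[of "i t"]] by auto
  ultimately have "edges_sq_le (sel (i (depth n)))
      ((3/4) ^ (depth n div (4 * CARD('d))) * (diameter (S0 D))\<^sup>2)"
    by (intro nested_bisections_edges[where R = "\<lambda>t. sel (i t)"]) auto
  from lp_bound_ge[OF admissible_sel this]
  show ?thesis
    by (rule order_trans) (use i(1) in \<open>auto simp: f_opt_def intro!: Max_ge\<close>)
qed

section \<open>The length of the longest nested sequence\<close>

text \<open>
  \<open>S\<close> arises from a nested sequence of \<open>l\<close> simplices that were selected before iteration \<open>k\<close>,
  as one of the halves of the last; \<open>l = 0\<close> makes no demand and serves the root.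
\<close>

definition reached :: "nat \<Rightarrow> 'd vsimplex \<Rightarrow> nat \<Rightarrow> bool" where
  "reached k S l \<longleftrightarrow> (\<exists>i::nat \<Rightarrow> nat. strict_mono_on {..<l} i \<and> (\<forall>j<l. i j < k) \<and>
     (\<forall>j. Suc j < l \<longrightarrow> sel (i (Suc j)) \<in> {T (i j), T' (i j)}) \<and>
     (0 < l \<longrightarrow> S \<in> {T (i (l - 1)), T' (i (l - 1))}))"

lemma reached_mono: "reached k S l \<Longrightarrow> reached (Suc k) S l"
  unfolding reached_def by (meson less_SucI)

lemma reached_child:
  assumes "reached k (sel k) l" "S \<in> {T k, T' k}"
  shows "reached (Suc k) S (Suc l)"
proof -
  obtain i where i: "strict_mono_on {..<l} i" "\<forall>j<l. i j < k"
    "\<forall>j. Suc j < l \<longrightarrow> sel (i (Suc j)) \<in> {T (i j), T' (i j)}"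
    "0 < l \<longrightarrow> sel k \<in> {T (i (l - 1)), T' (i (l - 1))}"
    using assms(1) by (auto simp: reached_def)
  have "strict_mono_on {..<Suc l} (i(l := k))"
    using i(1,2) by (auto simp: strict_mono_on_def less_Suc_eq)
  moreover have "\<forall>j<Suc l. (i(l := k)) j < Suc k"
    using i(2) by (auto simp: less_Suc_eq)
  moreover have "\<forall>j. Suc j < Suc l \<longrightarrow> sel ((i(l := k)) (Suc j)) \<in> {T ((i(l := k)) j), T' ((i(l := k)) j)}"
    using i(3,4) by (auto simp: less_Suc_eq)
  ultimately show ?thesis
    unfolding reached_def using assms(2) by (intro exI[of _ "i(l := k)"]) simp
qed

lemma reached_nested_chain:
  assumes "reached (Suc n) S (Suc l)"
  shows "nested_chain n l"
proof -
  obtain i where "strict_mono_on {..<Suc l} i" "\<forall>j<Suc l. i j < Suc n"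
    "\<forall>j. Suc j < Suc l \<longrightarrow> sel (i (Suc j)) \<in> {T (i j), T' (i j)}"
    using assms unfolding reached_def by blast
  moreover have "{..<Suc l} = {0..l}" by auto
  ultimately show ?thesis
    unfolding nested_chain_def by (intro exI[of _ i]) (simp add: less_Suc_eq_le)
qed

text \<open>
  Attach to each member of the collection the length of a nested sequence that leads to it.
  A bisection replaces a leaf of a binary tree by two leaves one level deeper, which preserves the
  sum of \<open>2\<^sup>-\<^sup>l\<close>.  The decorated multiset is only claimed to exist since equal vertex lists may occur
  several times, at different depths.
\<close>

lemma kraft_equality:
  "\<exists>A. image_mset fst A = Coll k \<and> (\<forall>(S, l)\<in>#A. reached k S l)
     \<and> (\<Sum>a\<in>#A. (1/2::real) ^ snd a) = 1"
proof (induction k)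
  case 0
  obtain V where "Coll 0 = {#V#}" by (rule root)
  then show ?case by (intro exI[of _ "{#(V, 0)#}"]) (simp add: reached_def)
next
  case (Suc k)
  then obtain A where A: "image_mset fst A = Coll k" "\<forall>(S, l)\<in>#A. reached k S l"
    "(\<Sum>a\<in>#A. (1/2::real) ^ snd a) = 1" by blast
  have "sel k \<in># image_mset fst A" unfolding A(1) by (rule run_step(1))
  then obtain l where "(sel k, l) \<in># A" by auto
  then obtain B where B: "A = add_mset (sel k, l) B" by (metis multi_member_split)
  have r: "reached k (sel k) l" using A(2) B by auto
  show ?case
  proof (intro exI[of _ "B + {#(T k, Suc l), (T' k, Suc l)#}"] conjI)
    show "image_mset fst (B + {#(T k, Suc l), (T' k, Suc l)#}) = Coll (Suc k)"
      unfolding run_step(4) A(1)[symmetric] B by simp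
    show "\<forall>(S, l)\<in>#B + {#(T k, Suc l), (T' k, Suc l)#}. reached (Suc k) S l"
      using A(2) B reached_child[OF r] reached_mono by auto
    show "(\<Sum>a\<in>#B + {#(T k, Suc l), (T' k, Suc l)#}. (1/2::real) ^ snd a) = 1"
      using A(3) B by simp
  qed
qed

lemma size_Coll: "size (Coll k) = Suc k"
proof (induction k)
  case 0
  obtain V where "Coll 0 = {#V#}" by (rule root)
  then show ?case by simp
next
  case (Suc k)
  then show ?case using run_step(1)[of k] by (simp add: run_step(4) size_Diff_singleton)
qed

text \<open>
  After \<open>n + 1\<close> bisections there are \<open>n + 2\<close> leaves, none deeper than \<open>depth n + 1\<close>.
\<close>

lemma two_power_depth: "n + 2 \<le> 2 ^ Suc (depth n)"
proof -
  obtain A where A: "image_mset fst A = Coll (Suc n)" "\<forall>(S, l)\<in>#A. reached (Suc n) S l"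
    "(\<Sum>a\<in>#A. (1/2::real) ^ snd a) = 1" using kraft_equality by blast
  have "(1/2::real) ^ Suc (depth n) \<le> (1/2) ^ snd a" if "a \<in># A" for a
  proof (rule power_decreasing)
    show "snd a \<le> Suc (depth n)"
    proof (cases "snd a")
      case (Suc l)
      have "reached (Suc n) (fst a) (Suc l)" using A(2) that Suc by (auto simp: case_prod_beta)
      then show ?thesis
        using Suc nested_chain_le_depth[OF reached_nested_chain] by simp
    qed simp
  qed auto
  then have "(\<Sum>a\<in>#A. (1/2::real) ^ Suc (depth n)) \<le> (\<Sum>a\<in>#A. (1/2) ^ snd a)"
    by (rule sum_mset_mono)
  moreover have "size A = n + 2"
    using size_Coll[of "Suc n"] A(1) by (metis add_2_eq_Suc' size_image_mset)
  ultimately have "real (n + 2) * (1/2) ^ Suc (depth n) \<le> 1"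
    unfolding A(3) by simp
  then have "real (n + 2) \<le> 2 ^ Suc (depth n)"
    by (simp add: power_one_over field_simps)
  also have "\<dots> = real (2 ^ Suc (depth n))" by simp
  finally show ?thesis by (simp only: of_nat_le_iff)
qed

end

text \<open>
  The tree estimate gives \<open>n \<le> 2^(L+1) - 2\<close>, and \<open>\<lfloor>ln n\<rfloor> + 1 \<le> L\<close> amounts to \<open>n < exp L\<close>.
  The bound is tight for small \<open>L\<close>: already \<open>exp 1 \<ge> 5/2\<close> just suffices for \<open>L = 2\<close>, where
  \<open>6 < 25/4\<close>.
\<close>

lemma two_power_less_exp:
  assumes "1 \<le> m"
  shows "2 ^ Suc m - 2 < exp (real m)"
proof -
  have "2 ^ Suc m - 2 < (5/2::real) ^ m"
  proof (cases "m = 1")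
    case False
    with assms have "2 \<le> m" by simp
    then show ?thesis
    proof (induction m rule: dec_induct)
      case base
      show ?case by (simp add: power2_eq_square)
    next
      case (step m)
      have "(5/2::real) ^ 2 \<le> (5/2) ^ m" by (rule power_increasing) (use step in auto)
      then show ?case using step.IH by (simp add: power2_eq_square)
    qed
  qed simp
  also have "\<dots> \<le> exp 1 ^ m"
    using exp_lower_Taylor_quadratic[of 1] by (intro power_mono) (simp_all add: power2_eq_square)
  also have "\<dots> = exp (real m)" by (simp add: exp_of_nat_mult[symmetric])
  finally show ?thesis .
qed

context pi_sfp
begin

lemma floor_ln_less_depth:
  assumes "1 \<le> n"
  shows "\<lfloor>ln (real n)\<rfloor> + 1 \<le> int (depth n)"
proof -
  have "1 \<le> depth n"
  proof (rule ccontr)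
    assume "\<not> 1 \<le> depth n"
    then have "depth n = 0" by simp
    then show False using two_power_depth[of n] assms by simp
  qed
  have "real (n + 2) \<le> real (2 ^ Suc (depth n))"
    using two_power_depth[of n] by (simp only: of_nat_le_iff)
  then have "real n < exp (real (depth n))"
    using two_power_less_exp[OF \<open>1 \<le> depth n\<close>] by simp
  then have "ln (real n) < real (depth n)"
    using assms by (metis exp_gt_zero ln_exp ln_less_cancel_iff of_nat_0_less_iff less_le_trans zero_less_one)
  then have "\<lfloor>ln (real n)\<rfloor> < int (depth n)" by (simp only: floor_less_iff of_int_of_nat_eq)
  then show ?thesis by (simp only: add1_zle_eq)
qed

section \<open>Rate of convergence\<close>

lemma f_opt_error:
  "\<bar>f_opt D tp sel n - ereal (f_low D)\<bar>
     \<le> ereal (rate * ((3/4) ^ (depth n div (4 * CARD('d))) * (diameter (S0 D))\<^sup>2))"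
  "\<bar>f_opt D tp sel n\<bar> \<noteq> \<infinity>"
  using f_opt_le[of n] f_opt_ge[of n] by (cases "f_opt D tp sel n"; simp)+

lemma filterlim_depth: "filterlim depth at_top sequentially"
  unfolding filterlim_at_top
proof
  fix m
  have "m \<le> depth n" if n: "n \<ge> nat \<lceil>exp (real m)\<rceil>" for n
  proof -
    have e: "exp (real m) \<le> real n" using n by linarith
    then have "1 \<le> n" using exp_gt_zero[of "real m"] by (metis Suc_leI One_nat_def of_nat_0_less_iff less_le_trans)
    have "real m \<le> ln (real n)" using e \<open>1 \<le> n\<close> by (simp add: ln_ge_iff)
    then have "int m \<le> \<lfloor>ln (real n)\<rfloor>" by (simp add: le_floor_iff)
    then show ?thesis using floor_ln_less_depth[OF \<open>1 \<le> n\<close>] by linarith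
  qed
  then show "\<forall>\<^sub>F n in sequentially. m \<le> depth n"
    unfolding eventually_sequentially by blast
qed

lemma f_opt_tendsto: "f_opt D tp sel \<longlonglongrightarrow> ereal (f_low D)"
proof -
  let ?E = "\<lambda>n. rate * ((3/4) ^ (depth n div (4 * CARD('d))) * (diameter (S0 D))\<^sup>2)"
  have "filterlim (\<lambda>n. depth n div (4 * CARD('d))) at_top sequentially"
    unfolding filterlim_at_top
  proof
    fix m
    have "\<forall>\<^sub>F n in sequentially. m * (4 * CARD('d)) \<le> depth n"
      using filterlim_depth by (simp add: filterlim_at_top)
    then show "\<forall>\<^sub>F n in sequentially. m \<le> depth n div (4 * CARD('d))"
      by eventually_elim (simp add: less_eq_div_iff_mult_less_eq)
  qed
  moreover have "(\<lambda>m. (3/4::real) ^ m) \<longlonglongrightarrow> 0" by (rule LIMSEQ_realpow_zero) auto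
  ultimately have "(\<lambda>n. (3/4::real) ^ (depth n div (4 * CARD('d)))) \<longlonglongrightarrow> 0"
    by (rule filterlim_compose[rotated])
  then have "(\<lambda>n. f_low D - ?E n) \<longlonglongrightarrow> f_low D - rate * (0 * (diameter (S0 D))\<^sup>2)"
    by (intro tendsto_intros)
  then have lim: "(\<lambda>n. ereal (f_low D - ?E n)) \<longlonglongrightarrow> ereal (f_low D)" by simp
  show ?thesis
    by (rule tendsto_sandwich[OF _ _ lim tendsto_const]) (use f_opt_ge f_opt_le in auto)
qed

lemma f_opt_bigo:
  "(\<lambda>n. real_of_ereal (f_opt D tp sel n) - f_low D)
     \<in> O(\<lambda>n. (3/4) ^ (depth n div (4 * CARD('d))))"
proof (rule bigoI[where c = "rate * (diameter (S0 D))\<^sup>2"], rule always_eventually, rule allI)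
  fix n
  show "norm (real_of_ereal (f_opt D tp sel n) - f_low D)
    \<le> rate * (diameter (S0 D))\<^sup>2 * norm ((3/4::real) ^ (depth n div (4 * CARD('d))))"
    using f_opt_error[of n] by (cases "f_opt D tp sel n") (auto simp: mult_ac)
qed

end

lemma (in latent_proxy_model) X_measurable: "X \<in> measurable M (count_space UNIV)"
proof -
  have "(\<lambda>\<omega>. (W \<omega>, U \<omega>, X \<omega>, Y \<omega>)) \<in> measurable M
     (count_space UNIV \<Otimes>\<^sub>M count_space UNIV \<Otimes>\<^sub>M count_space UNIV \<Otimes>\<^sub>M \<nu>)"
    using joint_density by (rule distributed_measurable)
  from measurable_compose[OF this, of "\<lambda>p. fst (snd (snd p))" "count_space UNIV"]
  show ?thesis by simp
qed

theorem theorem1: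
  fixes M :: "'o measure" and \<nu> :: "'y measure"
    and W :: "'o \<Rightarrow> 'w::finite" and U :: "'o \<Rightarrow> 'd::finite"
    and X :: "'o \<Rightarrow> 'x::countable" and Y :: "'o \<Rightarrow> 'y"
    and f :: "'w \<Rightarrow> 'd \<Rightarrow> 'x \<Rightarrow> 'y \<Rightarrow> real"
    and x :: 'x and y :: 'y
    and P_low P_upp :: "real^'d^'w"
    and D :: "('w, 'd) known_data"
    and \<delta> :: real
    and tp :: "'d tangency"
    and Coll :: "nat \<Rightarrow> 'd vsimplex multiset"
    and sel T T' :: "nat \<Rightarrow> 'd vsimplex"
    and L :: "nat \<Rightarrow> nat"
  assumes "2 \<le> CARD('d)"
    and "latent_proxy_model M \<nu> W U X Y f"
    and "y \<in> space \<nu>"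
    and "0 < \<P>(\<omega> in M. X \<omega> = x)"
    and "D = known_data_of M W X f x y P_low P_upp"
    and "IR_Phi D \<noteq> {}"
    and partial_observability: "P_low \<le> proxy_matrix M W U" "proxy_matrix M W U \<le> P_upp"
    and boundedness: "0 < \<delta>" "\<And>\<theta> \<psi> \<omega> i. (\<theta>, \<psi>, \<omega>) \<in> IR_Phi D \<Longrightarrow> \<delta> \<le> \<psi> $ i"
    and "\<And>S F. S \<noteq> [] \<Longrightarrow> tp S F \<in> hull_of S"
    and "pi_sfp_run D tp Coll sel T T'"
    and "L = longest_nested sel T T'"
  shows "(\<lambda>n. real_of_ereal (f_opt D tp sel n) - f_low D)
           \<in> O(\<lambda>n. (3/4) ^ (L n div (4 * CARD('d)))) \<and>
         (\<forall>n\<ge>1. \<bar>f_opt D tp sel n - ereal (f_low D)\<bar>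
           \<le> rate_const D \<delta> * ereal ((3/4) ^ (L n div (4 * CARD('d))) * (diameter (S0 D))^2)) \<and>
         rate_const D \<delta> < \<infinity> \<and>
         (\<forall>n\<ge>1. \<lfloor>ln (real n)\<rfloor> + 1 \<le> int (L n) \<and> L n \<le> n) \<and>
         f_opt D tp sel \<longlonglongrightarrow> ereal (f_low D)"
proof -
  interpret model: latent_proxy_model M \<nu> W U X Y f by (rule assms(2))
  have "{\<omega> \<in> space M. X \<omega> = x} \<in> sets M"
    using measurable_sets[OF model.X_measurable, of "{x}"] by (simp add: vimage_def Int_def conj_commute)
  moreover have "{\<omega> \<in> space M. X \<omega> \<noteq> x} = space M - {\<omega> \<in> space M. X \<omega> = x}" by auto
  ultimately have "fx D + fnx D \<le> 1"
    by (simp add: assms(5) known_data_of_def model.prob_compl)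
  then interpret pi_sfp D \<delta> tp Coll sel T T'
    using assms by unfold_locales auto
  show ?thesis
    unfolding \<open>L = longest_nested sel T T'\<close> rate_const_eq
    using f_opt_bigo f_opt_error floor_ln_less_depth nested_chain_le[OF nested_chain_depth]
      f_opt_tendsto by simp
qed

end
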